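(* Let $\mathbb{F}$ be a field of characteristic $0$ and $A=A_h$ with $h=\mathsf{u}_1^{\alpha_1}\cdots\mathsf{u}_t^{\alpha_t}$ as in the context, where $\alpha_1,\dots,\alpha_k\geq2$, $\alpha_{k+1}=\dots=\alpha_t=1$, and assume $k\geq1$; let $m_h=\max\{\alpha_j-1:1\leq j\leq k\}$. Then the $\mathrm{HH}^1(A)$-Lie module $\mathrm{HH}^2(A)$ (Gerstenhaber bracket) satisfies: (a) $\mathrm{HH}^2(A)=P_0\supsetneq P_1\supsetneq\cdots\supsetneq P_{m_h-1}\supsetneq P_{m_h}=0$ is a filtration of length $m_h$ by $\mathrm{HH}^1(A)$-submodules. (b) For each $0\leq i\leq m_h-1$, the factor $S_i=P_i/P_{i+1}$ is completely reducible with decomposition $S_i=\bigoplus_{\alpha_j\geq i+2}\overline{V}_{ij}$, where: (i) $\mathsf{Z}(\mathrm{HH}^1(A))\oplus\mathcal{N}$ acts trivially on $S_i$, so $S_i$ is a module over $(\overline{\mathsf{D}}_1\otimes\mathsf{W})\oplus\cdots\oplus(\overline{\mathsf{D}}_k\otimes\mathsf{W})$; (ii) $\overline{V}_{ij}\cong\overline{\mathsf{D}}_j\otimes V_{\mu_{ij}}$ with $\mu_{ij}=\frac{\alpha_j-i}{\alpha_j-1}$, and this is irreducible; (iii) $\overline{\mathsf{D}}_q\otimes\mathsf{W}$ acts trivially on $\overline{V}_{ij}$ for $q\neq j$, and $\overline{\mathsf{D}}_j\otimes\mathsf{W}$ acts on $\overline{V}_{ij}=\overline{\mathsf{D}}_j[\hat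 y]$ by $(g\bar e_j\otimes w_m).(f\bar e_j\hat y^\ell)=fg\bar e_j\,(\ell-(m+1)\mu_{ij})\hat y^{m+\ell}$; (iv) $\overline{V}_{ij}\cong\overline{V}_{i'j'}$ as $\mathrm{HH}^1(A)$-modules iff $(i,j)=(i',j')$. (c) $\mathrm{HH}^2(A)$ has finite composition length $\sum_{j=1}^k(\alpha_j-1)$ (the number of irreducible factors of $\gcd(h,h')$ counted with multiplicity), with composition factors $\{\overline{V}_{ij}:0\leq i\leq m_h-1,\ \alpha_j\geq i+2\}$, pairwise non-isomorphic. (d) $\mathrm{HH}^2(A)$ is a semisimple $\mathrm{HH}^1(A)$-module iff $m_h\leq1$, i.e. iff $h$ is not divisible by the cube of any non-constant polynomial.
   Context: $A=A_h$ is the unital subalgebra of the Weyl algebra $A_1=\mathbb{F}\langle x,y\mid yx-xy=1\rangle$ generated by $x$ and $\hat y=yh$, where $h=\mathsf{u}_1^{\alpha_1}\cdots\mathsf{u}_t^{\alpha_t}$ with $\mathsf{u}_i$ distinct monic irreducible polynomials. $\pi_h=\mathsf{u}_1\cdots\mathsf{u}_t$, $\gcd(h,h')=\mathsf{u}_1^{\alpha_1-1}\cdots\mathsf{u}_k^{\alpha_k-1}$. $a_n=\pi_hh^{n-1}y^n$ ($n\geq1$), $a_0=\pi_h/h$; for $g\in\mathbb{F}[x]$, $\mathrm{ad}_{ga_n}=[ga_n,-]$ is a derivation of $A$. $\delta_0(g)=(g\pi_h)'-g\pi_hh'/h$. $\mathrm{HH}^2(A)$ is identified with $\mathsf{D}[\hat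 y]$, $\mathsf{D}=\mathbb{F}[x]/\gcd(h,h')\mathbb{F}[x]$, via the standard minimal resolution (the class of $a\in A$ modulo $\gcd(h,h')A$ corresponds to the 2-cocycle with value $a$ on the generator), and in this identification the center of $\mathrm{HH}^1(A)$ acts by $0$ and $[\mathrm{ad}_{ga_n},p\hat y^k]=(n\pi_hgp'-ng\frac{\pi_hh'}{h}p-k\delta_0(g)p)\hat y^{n+k-1}$. It is known (earlier work) that $\mathrm{HH}^1(A)=\mathsf{Z}(\mathrm{HH}^1(A))\oplus[\mathrm{HH}^1(A),\mathrm{HH}^1(A)]$, that $\mathcal{N}=\mathrm{span}\{\mathrm{ad}_{ga_n}:g\in\mathsf{u}_1\cdots\mathsf{u}_k\mathbb{F}[x],n\geq0\}$ is the maximal nilpotent ideal of $[\mathrm{HH}^1(A),\mathrm{HH}^1(A)]$. $\Theta_i=\prod_{j=1}^k\mathsf{u}_j^{\min\{\alpha_j-1,i\}}$ and $P_i=\Theta_i\mathsf{D}[\hat y]$. Let $e_1,\dots,e_k\in\mathsf{D}$ be orthogonal idempotents summing to $1$ with $\mathsf{D}e_j\cong\mathbb{F}[x]/\mathsf{u}_j^{\alpha_j-1}$; let $\overline{\mathsf{D}}=\mathbb{F}[x]/\mathsf{u}_1\cdots\mathsf{u}_k\mathbb{F}[x]$, $\bar e_j$ the image of $e_j$, and $\overline{\mathsf{D}}_j=\overline{\mathsf{D}}\bar e_j\cong\mathbb{F}[x]/\mathsf{u}_j\mathbb{F}[x]$ (a field). For $0\leq i\leq m_h-1$, $S_i\cong\bigoplus_{\alpha_j\geq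 i+2}\overline{\mathsf{D}}_j[\hat y]$ via $\Theta_if\hat y^\ell+P_{i+1}\mapsto\sum_{\alpha_j\geq i+2}f\bar e_j\hat y^\ell$, and $\overline{V}_{ij}$ denotes the summand $\overline{\mathsf{D}}_j[\hat y]$. $\mathsf{W}=\mathrm{span}_{\mathbb{F}}\{w_m:m\geq-1\}$ with $[w_m,w_n]=(n-m)w_{m+n}$ (Witt algebra). Fix $\nu\in\mathbb{F}[x]$ with $\nu\delta_0(1)\equiv1\pmod{\mathsf{u}_1\cdots\mathsf{u}_k}$; there is a Lie algebra isomorphism $(\overline{\mathsf{D}}_1\otimes\mathsf{W})\oplus\cdots\oplus(\overline{\mathsf{D}}_k\otimes\mathsf{W})\cong[\mathrm{HH}^1(A),\mathrm{HH}^1(A)]/\mathcal{N}$ sending $g\bar e_q\otimes w_m$ to $-\mathrm{ad}_{ge_q\nu a_{m+1}}+\mathcal{N}$ (with $e_q$ lifted to $\mathbb{F}[x]$). For $\mu\in\mathbb{F}$, $V_\mu=\mathbb{F}[\hat y]$ is the $\mathsf{W}$-module with $w_m.\hat y^\ell=(\ell-(m+1)\mu)\hat y^{m+\ell}$; $\overline{\mathsf{D}}_j\otimes V_\mu$ is its scalar extension. *)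

theory Defs
  imports "HOL-Computational_Algebra.Computational_Algebra"
begin

text \<open>Concrete model. The polynomial h is the product of u j ^ alpha j over j < t
(indices 0..t-1; the first k factors have exponent at least 2).
HH^2(A) = D[y^] with D = F[x]/gcd(h,h'), represented by 'a poly poly (outer variable y^,
coefficients in F[x]) modulo the subspace Kset of those with all coefficients divisible by
gcd(h,h'). Submodules of HH^2(A) correspond to invariant subspaces containing Kset.\<close>

definition hP :: "(nat \<Rightarrow> 'a::field_gcd poly) \<Rightarrow> (nat \<Rightarrow> nat) \<Rightarrow> nat \<Rightarrow> 'a poly" where
  "hP u \<alpha> t = (\<Prod>j<t. u j ^ \<alpha> j)"

definition piH :: "(nat \<Rightarrow> 'a::field_gcd poly) \<Rightarrow> nat \<Rightarrow> 'a poly" where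
  "piH u t = (\<Prod>j<t. u j)"

text \<open>cH = pi_h * h' / h (a polynomial)\<close>
definition cH :: "(nat \<Rightarrow> 'a::field_gcd poly) \<Rightarrow> (nat \<Rightarrow> nat) \<Rightarrow> nat \<Rightarrow> 'a poly" where
  "cH u \<alpha> t = (piH u t * pderiv (hP u \<alpha> t)) div hP u \<alpha> t"

definition delta0 :: "(nat \<Rightarrow> 'a::field_gcd poly) \<Rightarrow> (nat \<Rightarrow> nat) \<Rightarrow> nat \<Rightarrow> 'a poly \<Rightarrow> 'a poly" where
  "delta0 u \<alpha> t g = pderiv (g * piH u t) - g * cH u \<alpha> t"

text \<open>Top u alpha t g n = the action of ad_{g a_n} on HH^2(A) = D[y^]:
  p y^l  |->  (n pi_h g p' - n g pi_h h'/h p - l delta0(g) p) y^(n+l-1).\<close>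
definition Top :: "(nat \<Rightarrow> 'a::field_gcd poly) \<Rightarrow> (nat \<Rightarrow> nat) \<Rightarrow> nat \<Rightarrow> 'a poly \<Rightarrow> nat
    \<Rightarrow> 'a poly poly \<Rightarrow> 'a poly poly" where
  "Top u \<alpha> t g n p = (\<Sum>l\<le>degree p.
      monom (of_nat n * piH u t * g * pderiv (coeff p l) - of_nat n * g * cH u \<alpha> t * coeff p l
             - of_nat l * delta0 u \<alpha> t g * coeff p l) (n + l - 1))"

definition Kset :: "(nat \<Rightarrow> 'a::field_gcd poly) \<Rightarrow> (nat \<Rightarrow> nat) \<Rightarrow> nat \<Rightarrow> 'a poly poly set" where
  "Kset u \<alpha> t = {p. \<forall>c. gcd (hP u \<alpha> t) (pderiv (hP u \<alpha> t)) dvd coeff p c}"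

definition Theta :: "(nat \<Rightarrow> 'a::field_gcd poly) \<Rightarrow> (nat \<Rightarrow> nat) \<Rightarrow> nat \<Rightarrow> nat \<Rightarrow> 'a poly" where
  "Theta u \<alpha> k i = (\<Prod>j<k. u j ^ min (\<alpha> j - 1) i)"

text \<open>Preimage of P_i = Theta_i D[y^] in 'a poly poly.\<close>
definition Pset :: "(nat \<Rightarrow> 'a::field_gcd poly) \<Rightarrow> (nat \<Rightarrow> nat) \<Rightarrow> nat \<Rightarrow> nat \<Rightarrow> 'a poly poly set" where
  "Pset u \<alpha> k i = {p. \<forall>c. Theta u \<alpha> k i dvd coeff p c}"

definition mh :: "(nat \<Rightarrow> nat) \<Rightarrow> nat \<Rightarrow> nat" where
  "mh \<alpha> k = Max ((\<lambda>j. \<alpha> j - 1) ` {..<k})"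

definition rad :: "(nat \<Rightarrow> 'a::field_gcd poly) \<Rightarrow> nat \<Rightarrow> 'a poly" where
  "rad u k = (\<Prod>j<k. u j)"

text \<open>Preimage in P_i of the summand Vbar_{ij} = Dbar_j[y^] of S_i = P_i/P_{i+1}:
  Theta_i r y^... whose image r in Dbar has zero component in Dbar_l for every other l
  occurring in S_i.\<close>
definition Vbar :: "(nat \<Rightarrow> 'a::field_gcd poly) \<Rightarrow> (nat \<Rightarrow> nat) \<Rightarrow> nat \<Rightarrow> nat \<Rightarrow> nat \<Rightarrow> 'a poly poly set" where
  "Vbar u \<alpha> k i j = {p \<in> Pset u \<alpha> k i. \<forall>c. \<forall>l<k. l \<noteq> j \<and> i + 2 \<le> \<alpha> l \<longrightarrow>
       u l dvd (coeff p c div Theta u \<alpha> k i)}"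

definition lsubspace :: "'a::field_gcd poly poly set \<Rightarrow> bool" where
  "lsubspace V \<longleftrightarrow> 0 \<in> V \<and> (\<forall>x\<in>V. \<forall>y\<in>V. x + y \<in> V) \<and> (\<forall>c x. x \<in> V \<longrightarrow> smult [:c:] x \<in> V)"

definition invariant :: "('b \<Rightarrow> nat \<Rightarrow> 'a::field_gcd poly poly \<Rightarrow> 'a poly poly) \<Rightarrow> 'a poly poly set \<Rightarrow> bool" where
  "invariant T V \<longleftrightarrow> lsubspace V \<and> (\<forall>g n. \<forall>x\<in>V. T g n x \<in> V)"

definition irred_sq :: "('b \<Rightarrow> nat \<Rightarrow> 'a::field_gcd poly poly \<Rightarrow> 'a poly poly) \<Rightarrow> 'a poly poly set
    \<Rightarrow> 'a poly poly set \<Rightarrow> bool" where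
  "irred_sq T U W \<longleftrightarrow> invariant T U \<and> invariant T W \<and> W \<subset> U \<and>
     (\<forall>V. invariant T V \<and> W \<subseteq> V \<and> V \<subseteq> U \<longrightarrow> V = W \<or> V = U)"

definition semisimple_sq :: "('b \<Rightarrow> nat \<Rightarrow> 'a::field_gcd poly poly \<Rightarrow> 'a poly poly) \<Rightarrow> 'a poly poly set
    \<Rightarrow> 'a poly poly set \<Rightarrow> bool" where
  "semisimple_sq T U W \<longleftrightarrow> invariant T U \<and> invariant T W \<and> W \<subseteq> U \<and>
     (\<forall>V. invariant T V \<and> W \<subseteq> V \<and> V \<subseteq> U \<longrightarrow>
        (\<exists>V'. invariant T V' \<and> W \<subseteq> V' \<and> V' \<subseteq> U \<and> V \<inter> V' = W \<and>
              (\<forall>x\<in>U. \<exists>a\<in>V. \<exists>b\<in>V'. x = a + b)))"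

definition iso_sq :: "('b \<Rightarrow> nat \<Rightarrow> 'a::field_gcd poly poly \<Rightarrow> 'a poly poly) \<Rightarrow> 'a poly poly set
    \<Rightarrow> 'a poly poly set \<Rightarrow> 'a poly poly set \<Rightarrow> 'a poly poly set \<Rightarrow> bool" where
  "iso_sq T U1 W1 U2 W2 \<longleftrightarrow> (\<exists>\<phi>. (\<forall>x y. \<phi> (x + y) = \<phi> x + \<phi> y) \<and>
     (\<forall>c x. \<phi> (smult [:c:] x) = smult [:c:] (\<phi> x)) \<and> \<phi> ` U1 \<subseteq> U2 \<and>
     (\<forall>x\<in>U1. \<phi> x \<in> W2 \<longleftrightarrow> x \<in> W1) \<and> (\<forall>y\<in>U2. \<exists>x\<in>U1. \<phi> x - y \<in> W2) \<and>
     (\<forall>g n. \<forall>x\<in>U1. \<phi> (T g n x) - T g n (\<phi> x) \<in> W2))"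

definition direct_sum_sq :: "('b \<Rightarrow> nat \<Rightarrow> 'a::field_gcd poly poly \<Rightarrow> 'a poly poly) \<Rightarrow> 'a poly poly set
    \<Rightarrow> 'a poly poly set \<Rightarrow> 'i set \<Rightarrow> ('i \<Rightarrow> 'a poly poly set) \<Rightarrow> bool" where
  "direct_sum_sq T U W I V \<longleftrightarrow> finite I \<and>
     (\<forall>j\<in>I. invariant T (V j) \<and> W \<subseteq> V j \<and> V j \<subseteq> U) \<and>
     (\<forall>x\<in>U. \<exists>f. (\<forall>j\<in>I. f j \<in> V j) \<and> x - (\<Sum>j\<in>I. f j) \<in> W) \<and>
     (\<forall>f. (\<forall>j\<in>I. f j \<in> V j) \<and> (\<Sum>j\<in>I. f j) \<in> W \<longrightarrow> (\<forall>j\<in>I. f j \<in> W))"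

definition comp_series :: "('b \<Rightarrow> nat \<Rightarrow> 'a::field_gcd poly poly \<Rightarrow> 'a poly poly) \<Rightarrow> 'a poly poly set
    \<Rightarrow> 'a poly poly set \<Rightarrow> (nat \<Rightarrow> 'a poly poly set) \<Rightarrow> nat \<Rightarrow> bool" where
  "comp_series T U W M n \<longleftrightarrow> M 0 = W \<and> M n = U \<and> (\<forall>l<n. irred_sq T (M (Suc l)) (M l))"

end

theory Submission
  imports Defs
begin

text \<open>Every subspace involved is the set of elements all of whose coefficients are divisible by some
product \<open>u\<^sub>1\<^bsup>\<beta>\<^sub>1\<^esup>\<dots>u\<^sub>k\<^bsup>\<beta>\<^sub>k\<^esup>\<close>. Raising \<open>\<beta>\<^sub>j\<close> by one gives a submodule whose quotient is a copy of
\<open>(F[x]/u\<^sub>j)[y]\<close>, on which \<open>g a\<^sub>n\<close> maps \<open>q y\<^sup>l\<close> to \<open>(l(\<alpha>\<^sub>j - 1) - n(\<alpha>\<^sub>j - \<beta>\<^sub>j)) q g \<kappa>\<^sub>j y\<^sup>n\<^sup>+\<^sup>l\<^sup>-\<^sup>1\<close> with \<open>\<kappa>\<^sub>j\<close> a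
unit modulo \<open>u\<^sub>j\<close>. This formula gives irreducibility, and shows that the isomorphism type of the
quotient is determined by \<open>j\<close> and \<open>\<beta>\<^sub>j\<close> (through the vectors killed by \<open>a\<^sub>0\<close>). Any chain of exponent
vectors is therefore a composition series, and the Jordan--Hoelder theorem yields all the others.\<close>

section \<open>Modules over a family of linear operators\<close>

text \<open>The weights come from logarithmic derivatives: for p a product of powers
  \<open>u j ^ \<beta> j\<close>, the expression \<open>piH * p' / p\<close> is a sum of terms
  \<open>\<beta> j * kap j\<close>, and modulo \<open>u j\<close> only the term of \<open>j\<close>
  survives. In the same way \<open>cH\<close> becomes \<open>\<alpha> j * kap j\<close>, the
  derivative of \<open>piH\<close> becomes \<open>kap j\<close>, and \<open>delta0 g\<close> becomes
  \<open>- (\<alpha> j - 1) * g * kap j\<close>. Multiplication by \<open>\<nu>\<close> divides the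
  weight by \<open>\<alpha> j - 1\<close>, whence \<mu> = (\<alpha> j - i) / (\<alpha> j - 1).
  Irreducibility rests on two nonvanishing weights: for n = 0 and l > 0, by
  \<open>\<alpha> j \<ge> 2\<close>, and for l = 0 and n > 0, by
  \<open>\<beta> j < \<alpha> j\<close>. No quotient is ever formed: a factor is a pair of nested
  subspaces, and an isomorphism is a linear map of the whole space, controlled modulo the smaller
  subspace of its target.\<close>

lemma lsubspaceD:
  assumes "lsubspace V"
  shows "0 \<in> V" and "x \<in> V \<Longrightarrow> y \<in> V \<Longrightarrow> x + y \<in> V" and "x \<in> V \<Longrightarrow> smult [:c:] x \<in> V"
    and "x \<in> V \<Longrightarrow> - x \<in> V" and "x \<in> V \<Longrightarrow> y \<in> V \<Longrightarrow> x - y \<in> V"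
proof -
  show 0: "0 \<in> V" and add: "x \<in> V \<Longrightarrow> y \<in> V \<Longrightarrow> x + y \<in> V"
    and sm: "x \<in> V \<Longrightarrow> smult [:c:] x \<in> V" for x y c
    using assms unfolding lsubspace_def by auto
  show neg: "x \<in> V \<Longrightarrow> - x \<in> V" for x
    using sm[of x "-1"] by (metis minus_pCons minus_zero smult_1_left smult_minus_left one_pCons)
  show "x \<in> V \<Longrightarrow> y \<in> V \<Longrightarrow> x - y \<in> V"
    using add[of x "- y"] neg[of y] by simp
qed

lemma lsubspace_sum: "lsubspace V \<Longrightarrow> (\<And>j. j \<in> J \<Longrightarrow> f j \<in> V) \<Longrightarrow> sum f J \<in> V"
  by (induction J rule: infinite_finite_induct) (auto simp: lsubspaceD)

lemma invariantD:
  assumes "invariant T V"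
  shows "lsubspace V" and "x \<in> V \<Longrightarrow> T g n x \<in> V"
  using assms by (auto simp: invariant_def)

lemmas inv_subspace = lsubspaceD[OF invariantD(1)]

definition set_plus :: "'a::ab_group_add set \<Rightarrow> 'a set \<Rightarrow> 'a set" where
  "set_plus A B = {a + b | a b. a \<in> A \<and> b \<in> B}"

lemma set_plusI: "a \<in> A \<Longrightarrow> b \<in> B \<Longrightarrow> a + b \<in> set_plus A B"
  by (auto simp: set_plus_def)

lemma set_plusE:
  assumes "x \<in> set_plus A B"
  obtains a b where "a \<in> A" "b \<in> B" "x = a + b"
  using assms by (auto simp: set_plus_def)

lemma lsubspace_set_plus:
  assumes A: "lsubspace A" and B: "lsubspace B"
  shows "lsubspace (set_plus A B)"
  unfolding lsubspace_def
proof (intro conjI allI ballI impI)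
  show "0 \<in> set_plus A B"
    using set_plusI[OF lsubspaceD(1)[OF A] lsubspaceD(1)[OF B]] by simp
next
  fix x y assume "x \<in> set_plus A B" "y \<in> set_plus A B"
  then obtain a b a' b' where "a \<in> A" "b \<in> B" "x = a + b" "a' \<in> A" "b' \<in> B" "y = a' + b'"
    by (auto elim!: set_plusE)
  moreover from this have "(a + a') + (b + b') \<in> set_plus A B"
    by (intro set_plusI lsubspaceD A B)
  ultimately show "x + y \<in> set_plus A B"
    by (simp add: add_ac)
next
  fix c x assume "x \<in> set_plus A B"
  then obtain a b where "a \<in> A" "b \<in> B" "x = a + b"
    by (auto elim!: set_plusE)
  moreover from this have "smult [:c:] a + smult [:c:] b \<in> set_plus A B"
    by (intro set_plusI lsubspaceD A B)
  ultimately show "smult [:c:] x \<in> set_plus A B"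
    by (simp add: smult_add_right)
qed

lemma set_plus_subset:
  "lsubspace V \<Longrightarrow> A \<subseteq> V \<Longrightarrow> B \<subseteq> V \<Longrightarrow> set_plus A B \<subseteq> V"
  by (auto intro!: lsubspaceD(2) elim!: set_plusE)

lemma subset_set_plus1: "lsubspace B \<Longrightarrow> A \<subseteq> set_plus A B"
  using set_plusI[OF _ lsubspaceD(1)] by fastforce

lemma subset_set_plus2: "lsubspace A \<Longrightarrow> B \<subseteq> set_plus A B"
  using set_plusI[OF lsubspaceD(1)] by fastforce

lemma invariant_Int: "invariant T A \<Longrightarrow> invariant T B \<Longrightarrow> invariant T (A \<inter> B)"
  by (auto simp: invariant_def lsubspace_def)

locale linear_operators =
  fixes T :: "'b \<Rightarrow> nat \<Rightarrow> 'a::field_gcd poly poly \<Rightarrow> 'a poly poly"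
  assumes T_add: "T g n (x + y) = T g n x + T g n y"
    and T_smult: "T g n (smult [:c:] x) = smult [:c:] (T g n x)"
begin

lemma T_diff: "T g n (x - y) = T g n x - T g n y"
  using T_add[of g n "x - y" y] by simp

lemma invariant_set_plus:
  assumes A: "invariant T A" and B: "invariant T B"
  shows "invariant T (set_plus A B)"
  using lsubspace_set_plus[of A B] A B
  by (auto simp: invariant_def T_add set_plusI elim!: set_plusE)

text \<open>\<open>W + X\<close> is invariant, lies between \<open>W\<close> and \<open>U\<close>
  and is strictly larger than \<open>W\<close>, so irreducibility leaves only
  \<open>U\<close>.\<close>

lemma irred_sq_decompose:
  assumes irr: "irred_sq T U W" and X: "invariant T X" "X \<subseteq> U" "\<not> X \<subseteq> W" and y: "y \<in> U"
  obtains w x where "w \<in> W" "x \<in> X" "y = w + x"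
proof -
  have inv: "invariant T W" "invariant T U" "W \<subseteq> U"
    using irr by (auto simp: irred_sq_def)
  have "invariant T (set_plus W X)" "W \<subseteq> set_plus W X" "set_plus W X \<subseteq> U"
    using invariant_set_plus[OF inv(1) X(1)] subset_set_plus1[OF invariantD(1)[OF X(1)], of W]
      set_plus_subset[OF invariantD(1)[OF inv(2)] inv(3) X(2)] by auto
  moreover have "set_plus W X \<noteq> W"
    using subset_set_plus2[OF invariantD(1)[OF inv(1)], of X] X by auto
  ultimately have "set_plus W X = U"
    using irr unfolding irred_sq_def by blast
  then show ?thesis
    using y that by (auto elim!: set_plusE)
qed

subsection \<open>Isomorphism of subquotients\<close>

text \<open>The body of \<open>iso_sq\<close> with its witness exposed. The membership equivalence
  says at once that the induced map \<open>U1 / W1\<close> to \<open>U2 / W2\<close> is well defined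
  and injective; the existence clause is surjectivity.\<close>

definition sq_map :: "('a poly poly \<Rightarrow> 'a poly poly) \<Rightarrow> 'a poly poly set \<Rightarrow> 'a poly poly set
    \<Rightarrow> 'a poly poly set \<Rightarrow> 'a poly poly set \<Rightarrow> bool" where
  "sq_map \<phi> U1 W1 U2 W2 \<longleftrightarrow> (\<forall>x y. \<phi> (x + y) = \<phi> x + \<phi> y) \<and>
     (\<forall>c x. \<phi> (smult [:c:] x) = smult [:c:] (\<phi> x)) \<and> \<phi> ` U1 \<subseteq> U2 \<and>
     (\<forall>x\<in>U1. \<phi> x \<in> W2 \<longleftrightarrow> x \<in> W1) \<and> (\<forall>y\<in>U2. \<exists>x\<in>U1. \<phi> x - y \<in> W2) \<and>
     (\<forall>g n. \<forall>x\<in>U1. \<phi> (T g n x) - T g n (\<phi> x) \<in> W2)"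

lemma iso_sq_iff: "iso_sq T U1 W1 U2 W2 \<longleftrightarrow> (\<exists>\<phi>. sq_map \<phi> U1 W1 U2 W2)"
  by (simp add: iso_sq_def sq_map_def)

lemma sq_mapD:
  assumes "sq_map \<phi> U1 W1 U2 W2"
  shows "\<phi> (x + y) = \<phi> x + \<phi> y" and "\<phi> (smult [:c:] x) = smult [:c:] (\<phi> x)" and "\<phi> ` U1 \<subseteq> U2"
    and "x \<in> U1 \<Longrightarrow> \<phi> x \<in> W2 \<longleftrightarrow> x \<in> W1" and "y \<in> U2 \<Longrightarrow> \<exists>x\<in>U1. \<phi> x - y \<in> W2"
    and "x \<in> U1 \<Longrightarrow> \<phi> (T g n x) - T g n (\<phi> x) \<in> W2" and "\<phi> (x - y) = \<phi> x - \<phi> y"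
proof -
  show *: "\<phi> (x + y) = \<phi> x + \<phi> y" for x y
    using assms by (simp add: sq_map_def)
  show "\<phi> (x - y) = \<phi> x - \<phi> y"
    using *[of "x - y" y] by simp
qed (use assms in \<open>auto simp: sq_map_def\<close>)

lemma iso_sq_refl:
  assumes "lsubspace W"
  shows "iso_sq T U W U W"
  unfolding iso_sq_def using lsubspaceD(1)[OF assms]
  by (intro exI[of _ "\<lambda>x. x"]) (auto intro!: bexI)

lemma iso_sq_trans:
  assumes "iso_sq T U1 W1 U2 W2" and "iso_sq T U2 W2 U3 W3"
    and inv: "invariant T U1" "invariant T U2" "lsubspace W3"
  shows "iso_sq T U1 W1 U3 W3"
proof -
  obtain \<phi> where "sq_map \<phi> U1 W1 U2 W2"
    using assms(1) iso_sq_iff by blast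
  note \<phi> = sq_mapD[OF this]
  obtain \<psi> where "sq_map \<psi> U2 W2 U3 W3"
    using assms(2) iso_sq_iff by blast
  note \<psi> = sq_mapD[OF this]
  note sub2 = inv_subspace[OF inv(2)] and sub3 = lsubspaceD[OF inv(3)]
  show ?thesis
    unfolding iso_sq_def
  proof (intro exI[of _ "\<psi> \<circ> \<phi>"] conjI allI ballI)
    show "(\<psi> \<circ> \<phi>) (x + y) = (\<psi> \<circ> \<phi>) x + (\<psi> \<circ> \<phi>) y" for x y
      by (simp add: \<phi> \<psi>)
    show "(\<psi> \<circ> \<phi>) (smult [:c:] x) = smult [:c:] ((\<psi> \<circ> \<phi>) x)" for c x
      by (simp add: \<phi> \<psi>)
    show "(\<psi> \<circ> \<phi>) ` U1 \<subseteq> U3"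
      using \<phi>(3) \<psi>(3) by fastforce
    show "((\<psi> \<circ> \<phi>) x \<in> W3) = (x \<in> W1)" if "x \<in> U1" for x
      using \<phi>(3,4) \<psi>(4) that by fastforce
    show "\<exists>x\<in>U1. (\<psi> \<circ> \<phi>) x - y \<in> W3" if y: "y \<in> U3" for y
    proof -
      obtain z where z: "z \<in> U2" "\<psi> z - y \<in> W3" using \<psi>(5) y by blast
      obtain x where x: "x \<in> U1" "\<phi> x - z \<in> W2" using \<phi>(5) z by blast
      have "\<psi> (\<phi> x - z) \<in> W3"
        using \<psi>(4)[of "\<phi> x - z"] x z \<phi>(3) by (auto intro: sub2)
      with z have "\<psi> (\<phi> x - z) + (\<psi> z - y) \<in> W3" by (intro sub3(2))
      then show ?thesis using x by (auto simp: \<psi>(7))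
    qed
    show "(\<psi> \<circ> \<phi>) (T g n x) - T g n ((\<psi> \<circ> \<phi>) x) \<in> W3" if x: "x \<in> U1" for g n x
    proof -
      have mem: "\<phi> (T g n x) \<in> U2" "T g n (\<phi> x) \<in> U2" "\<phi> x \<in> U2"
        using x \<phi>(3) invariantD(2)[OF inv(1)] invariantD(2)[OF inv(2)] by auto
      have "\<psi> (\<phi> (T g n x) - T g n (\<phi> x)) \<in> W3"
        using \<psi>(4)[of "\<phi> (T g n x) - T g n (\<phi> x)"] \<phi>(6)[OF x] mem by (auto intro: sub2)
      with \<psi>(6)[OF mem(3)]
      have "\<psi> (\<phi> (T g n x) - T g n (\<phi> x)) + (\<psi> (T g n (\<phi> x)) - T g n (\<psi> (\<phi> x))) \<in> W3"
        by (intro sub3(2))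
      then show ?thesis by (simp add: \<psi>(7))
    qed
  qed
qed

text \<open>An isomorphism of subquotients is witnessed by a map defined on the whole space, so its
inverse has to be extended linearly from a basis.\<close>

lemma iso_sq_sym:
  assumes iso: "iso_sq T U1 W1 U2 W2"
    and inv: "invariant T U1" "invariant T W1" "invariant T U2" "invariant T W2"
  shows "iso_sq T U2 W2 U1 W1"
proof -
  let ?s = "\<lambda>(c::'a) (x::'a poly poly). smult [:c:] x"
  interpret V: vector_space ?s
    by unfold_locales (auto simp: smult_add_right smult_add_left[symmetric] pCons_one mult.commute)
  interpret P: vector_space_pair ?s ?s ..
  obtain \<phi> where "sq_map \<phi> U1 W1 U2 W2"
    using iso iso_sq_iff by blast
  note \<phi> = sq_mapD[OF this]
  have \<phi>0: "\<phi> 0 = 0"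
    using \<phi>(7)[of 0 0] by simp
  note sub1 = inv_subspace[OF inv(1)] and sub2 = inv_subspace[OF inv(3)]
    and subW1 = inv_subspace[OF inv(2)] and subW2 = inv_subspace[OF inv(4)]
  \<comment> \<open>\<open>r\<close> chooses preimages modulo \<open>W2\<close> without any
    linearity; only its values on a basis of \<open>U2\<close> are kept.\<close>
  obtain r where r: "\<And>y. y \<in> U2 \<Longrightarrow> r y \<in> U1 \<and> \<phi> (r y) - y \<in> W2"
    using \<phi>(5) by metis
  obtain B where B: "B \<subseteq> U2" "V.independent B" "U2 \<subseteq> V.span B"
    by (rule V.maximal_independent_subset)
  obtain \<psi> where lin: "Vector_Spaces.linear ?s ?s \<psi>" and \<psi>B: "\<And>x. x \<in> B \<Longrightarrow> \<psi> x = r x"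
    using P.linear_independent_extend[OF B(2), of r] by blast
  interpret L: Vector_Spaces.linear ?s ?s \<psi> by (rule lin)
  have \<psi>: "\<psi> y \<in> U1 \<and> \<phi> (\<psi> y) - y \<in> W2" if "y \<in> U2" for y
  proof -
    have "y \<in> V.span B" using that B(3) by blast
    then show ?thesis
    proof (induction rule: V.span_induct)
      case base
      show ?case
        unfolding V.subspace_def
      proof (intro conjI ballI allI CollectI)
        show "\<psi> 0 \<in> U1" "\<phi> (\<psi> 0) - 0 \<in> W2"
          by (simp_all add: L.zero \<phi>0 sub1 subW2)
        fix x y assume x: "x \<in> {a. \<psi> a \<in> U1 \<and> \<phi> (\<psi> a) - a \<in> W2}"
        {
          assume y: "y \<in> {a. \<psi> a \<in> U1 \<and> \<phi> (\<psi> a) - a \<in> W2}"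
          show "\<psi> (x + y) \<in> U1"
            using x y by (simp add: L.add sub1)
          have "(\<phi> (\<psi> x) - x) + (\<phi> (\<psi> y) - y) \<in> W2"
            using x y by (simp add: subW2)
          then show "\<phi> (\<psi> (x + y)) - (x + y) \<in> W2"
            by (simp add: L.add \<phi> algebra_simps)
        }
        fix c
        show "\<psi> (smult [:c:] x) \<in> U1"
          using x by (simp add: L.scale sub1)
        have "smult [:c:] (\<phi> (\<psi> x) - x) \<in> W2"
          using x by (simp add: subW2)
        then show "\<phi> (\<psi> (smult [:c:] x)) - smult [:c:] x \<in> W2"
          by (simp add: L.scale \<phi> smult_diff_right)
      qed
    next
      case (step x)
      then show ?case using \<psi>B B(1) r by auto
    qed
  qed
  have cancel: "x \<in> W1" if "x \<in> U1" "\<phi> x \<in> W2" for x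
    using \<phi>(4) that by blast
  show ?thesis
    unfolding iso_sq_def
  proof (intro exI[of _ \<psi>] conjI allI ballI)
    show "\<psi> (x + y) = \<psi> x + \<psi> y" for x y by (rule L.add)
    show "\<psi> (smult [:c:] x) = smult [:c:] (\<psi> x)" for c x by (rule L.scale)
    show "\<psi> ` U2 \<subseteq> U1" using \<psi> by blast
    show "(\<psi> x \<in> W1) = (x \<in> W2)" if x: "x \<in> U2" for x
    proof -
      have "\<phi> (\<psi> x) \<in> W2 \<longleftrightarrow> x \<in> W2"
        using subW2(5)[of "\<phi> (\<psi> x)" "\<phi> (\<psi> x) - x"] subW2(2)[of "\<phi> (\<psi> x) - x" x] \<psi>[OF x] by auto
      then show ?thesis using \<phi>(4) \<psi>[OF x] by blast
    qed
    show "\<exists>x\<in>U2. \<psi> x - y \<in> W1" if y: "y \<in> U1" for y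
    proof
      show "\<phi> y \<in> U2" using y \<phi>(3) by blast
      then show "\<psi> (\<phi> y) - y \<in> W1"
        using \<psi>[of "\<phi> y"] y by (intro cancel sub1) (auto simp: \<phi>(7))
    qed
    show "\<psi> (T g n x) - T g n (\<psi> x) \<in> W1" if x: "x \<in> U2" for g n x
    proof (rule cancel)
      have Tx: "T g n x \<in> U2" and \<psi>x: "\<psi> x \<in> U1"
        using invariantD(2)[OF inv(3) x] \<psi>[OF x] by auto
      show "\<psi> (T g n x) - T g n (\<psi> x) \<in> U1"
        using \<psi>[OF Tx] invariantD(2)[OF inv(1) \<psi>x] by (intro sub1) auto
      have "(\<phi> (\<psi> (T g n x)) - T g n x) - T g n (\<phi> (\<psi> x) - x)
          - (\<phi> (T g n (\<psi> x)) - T g n (\<phi> (\<psi> x))) \<in> W2"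
        using \<psi>[OF Tx] \<psi>[OF x] \<phi>(6)[OF \<psi>x] invariantD(2)[OF inv(4)]
        by (intro subW2(5)[OF subW2(5)]) auto
      then show "\<phi> (\<psi> (T g n x) - T g n (\<psi> x)) \<in> W2"
        by (simp add: \<phi>(7) T_diff)
    qed
  qed
qed

text \<open>The action of \<open>T g 1\<close> on the vectors killed by \<open>T g\<^sub>0 0\<close> is an isomorphism invariant that
  separates the composition factors of \<open>HH\<^sup>2\<close>.\<close>

lemma iso_sq_transfer_eigen:
  assumes iso: "iso_sq T U1 W1 U2 W2"
    and inv: "invariant T U1" "invariant T U2" "invariant T W2"
    and eigen: "\<forall>x\<in>U1. T g\<^sub>0 0 x \<in> W1 \<longrightarrow> T g 1 x - smult [:c:] x \<in> W1"
  shows "\<forall>x\<in>U2. T g\<^sub>0 0 x \<in> W2 \<longrightarrow> T g 1 x - smult [:c:] x \<in> W2"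
proof (intro ballI impI)
  fix y assume y: "y \<in> U2" "T g\<^sub>0 0 y \<in> W2"
  obtain \<phi> where "sq_map \<phi> U1 W1 U2 W2"
    using iso iso_sq_iff by blast
  note \<phi> = sq_mapD[OF this] and sub1 = inv_subspace[OF inv(1)] and subW2 = inv_subspace[OF inv(3)]
  obtain x where x: "x \<in> U1" "\<phi> x - y \<in> W2"
    using \<phi>(5)[OF y(1)] by blast
  have "(\<phi> (T g\<^sub>0 0 x) - T g\<^sub>0 0 (\<phi> x)) + (T g\<^sub>0 0 (\<phi> x - y) + T g\<^sub>0 0 y) \<in> W2"
    by (intro subW2(2) \<phi>(6) x y invariantD(2)[OF inv(3)])
  then have "T g\<^sub>0 0 x \<in> W1"
    using \<phi>(4) invariantD(2)[OF inv(1) x(1)] by (simp add: T_diff)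
  then have mem: "T g 1 x - smult [:c:] x \<in> W1"
    using eigen x by blast
  have "T g 1 x - smult [:c:] x \<in> U1"
    using x invariantD(2)[OF inv(1)] by (intro sub1(3,5))
  then have "\<phi> (T g 1 x - smult [:c:] x) \<in> W2"
    using \<phi>(4) mem by blast
  then have "(\<phi> (T g 1 x - smult [:c:] x) - (\<phi> (T g 1 x) - T g 1 (\<phi> x)))
      - (T g 1 (\<phi> x - y) - smult [:c:] (\<phi> x - y)) \<in> W2"
    using x invariantD(2)[OF inv(3)] by (intro subW2(5)[OF subW2(5)[OF _ \<phi>(6)] subW2(5)[OF _ subW2(3)]]) auto
  then show "T g 1 y - smult [:c:] y \<in> W2"
    by (simp add: \<phi>(2,7) T_diff smult_diff_right)
qed

text \<open>The identity map is the witness, as in the second isomorphism theorem. \<open>Y\<close>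
  is any set that agrees with \<open>W\<close> on \<open>X\<close>, so that it can be given in
  closed form instead of as \<open>X \<inter> W\<close>.\<close>

lemma iso_sq_inclusion:
  assumes "lsubspace W" "X \<subseteq> U" "\<And>x. x \<in> X \<Longrightarrow> x \<in> W \<longleftrightarrow> x \<in> Y"
    and "\<And>y. y \<in> U \<Longrightarrow> \<exists>x\<in>X. x - y \<in> W"
  shows "iso_sq T X Y U W"
  unfolding iso_sq_def using assms lsubspaceD(1)[OF assms(1)]
  by (intro exI[of _ "\<lambda>x. x"]) auto

lemma irred_sq_iso_Int:
  assumes irr: "irred_sq T U W" and X: "invariant T X" "X \<subseteq> U" "\<not> X \<subseteq> W"
  shows "iso_sq T X (X \<inter> W) U W"
proof (rule iso_sq_inclusion)
  show W: "lsubspace W"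
    using irr invariantD by (auto simp: irred_sq_def)
  show "\<exists>x\<in>X. x - y \<in> W" if y: "y \<in> U" for y
  proof -
    obtain w x where "w \<in> W" "x \<in> X" "y = w + x"
      using irred_sq_decompose[OF irr X y] .
    then show ?thesis using lsubspaceD(4)[OF W, of w] by (intro bexI[of _ x]) auto
  qed
qed (use X in auto)

subsection \<open>The Jordan--Hoelder theorem\<close>

lemma comp_series_mono:
  assumes "comp_series T U W M n" "a \<le> b" "b \<le> n"
  shows "M a \<subseteq> M b"
  using assms(2,3)
proof (induction b rule: dec_induct)
  case (step b)
  then have "M b \<subset> M (Suc b)"
    using assms(1) by (auto simp: comp_series_def irred_sq_def)
  with step show ?case by auto
qed simp

lemma comp_series_irred:
  "comp_series T U W M n \<Longrightarrow> l < n \<Longrightarrow> irred_sq T (M (Suc l)) (M l)"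
  by (simp add: comp_series_def)

lemma comp_series_invariant:
  assumes "comp_series T U W M n" "invariant T U" "l \<le> n"
  shows "invariant T (M l)"
proof (cases "l = n")
  case True
  then show ?thesis using assms by (simp add: comp_series_def)
next
  case False
  then show ?thesis using assms comp_series_irred[of U W M n l] by (auto simp: irred_sq_def)
qed

text \<open>The Zassenhaus correspondence: step \<open>l\<close> of \<open>M\<close> corresponds to step \<open>r\<close> of \<open>N\<close> if
  refining the former by \<open>N\<close> jumps exactly at \<open>r\<close>.\<close>

definition meets :: "(nat \<Rightarrow> 'a poly poly set) \<Rightarrow> (nat \<Rightarrow> 'a poly poly set) \<Rightarrow> nat \<Rightarrow> nat \<Rightarrow> bool" where
  "meets M N l r \<longleftrightarrow> \<not> M (Suc l) \<inter> N (Suc r) \<subseteq> M l \<and> M (Suc l) \<inter> N r \<subseteq> M l"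

text \<open>\<open>M (Suc l) \<inter> N r\<close> lies in \<open>M l\<close> for r = 0, being inside
  \<open>W\<close>, but not for r = n', being all of \<open>M (Suc l)\<close>. The jump is the
  predecessor of the least index at which it escapes.\<close>

lemma meets_ex:
  assumes M: "comp_series T U W M n" and N: "comp_series T U W N n'" and l: "l < n"
  shows "\<exists>r<n'. meets M N l r"
proof -
  let ?Q = "\<lambda>r. \<not> M (Suc l) \<inter> N r \<subseteq> M l"
  have "M (Suc l) \<subseteq> U" "W \<subseteq> M l"
    using comp_series_mono[OF M, of "Suc l" n] comp_series_mono[OF M, of 0 l] M l
    by (auto simp: comp_series_def)
  moreover have "M l \<subset> M (Suc l)"
    using comp_series_irred[OF M l] by (simp add: irred_sq_def)
  ultimately have Q: "?Q n'" "\<not> ?Q 0"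
    using N by (auto simp: comp_series_def)
  define s where "s = (LEAST r. ?Q r)"
  have s: "?Q s" "s \<le> n'" "\<And>r. r < s \<Longrightarrow> \<not> ?Q r"
    unfolding s_def using LeastI[of ?Q, OF Q(1)] Least_le[of ?Q, OF Q(1)] not_less_Least by blast+
  then obtain r where r: "s = Suc r"
    using Q(2) by (cases s) auto
  then show ?thesis
    using s by (intro exI[of _ r]) (auto simp: meets_def)
qed

lemma meets_unique:
  assumes N: "comp_series T U W N n'" and "r < n'" "r' < n'" "meets M N l r" "meets M N l r'"
  shows "r = r'"
proof -
  have "r' \<le> r" if "meets M N l r" "meets M N l r'" "r < n'" "r' < n'" for r r'
  proof (rule ccontr)
    assume "\<not> r' \<le> r"
    then have "N (Suc r) \<subseteq> N r'"
      using comp_series_mono[OF N, of "Suc r" r'] that by auto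
    then show False using that by (auto simp: meets_def)
  qed
  then show ?thesis using assms by (metis order_antisym)
qed

text \<open>Together the conclusions say \<open>meets N M r l\<close>. If
  \<open>N (Suc r) \<inter> M l\<close> escaped \<open>N r\<close>, it would span
  \<open>N (Suc r)\<close> modulo \<open>N r\<close>; each element of
  \<open>M (Suc l) \<inter> N (Suc r)\<close> would be a + b with b in \<open>M l\<close> and a in
  \<open>M (Suc l) \<inter> N r\<close>, which is inside \<open>M l\<close>, so there would be no
  jump at \<open>r\<close>.\<close>

lemma meets_facts:
  assumes M: "comp_series T U W M n" and N: "comp_series T U W N n'" and U: "invariant T U"
    and l: "l < n" and r: "r < n'" and meets: "meets M N l r"
  shows "\<not> M (Suc l) \<inter> N (Suc r) \<subseteq> N r" and "N (Suc r) \<inter> M l \<subseteq> N r"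
proof -
  have invM: "invariant T (M (Suc l))" "invariant T (M l)"
    using comp_series_invariant[OF M U] l by auto
  have invN: "invariant T (N (Suc r))" "invariant T (N r)"
    using comp_series_invariant[OF N U] r by auto
  have MM: "M l \<subseteq> M (Suc l)" and NN: "N r \<subseteq> N (Suc r)"
    using comp_series_irred[OF M l] comp_series_irred[OF N r] by (auto simp: irred_sq_def)
  show 1: "\<not> M (Suc l) \<inter> N (Suc r) \<subseteq> N r"
    using meets by (auto simp: meets_def)
  show "N (Suc r) \<inter> M l \<subseteq> N r"
  proof (rule ccontr)
    assume not: "\<not> N (Suc r) \<inter> M l \<subseteq> N r"
    have "M (Suc l) \<inter> N (Suc r) \<subseteq> M l"
    proof
      fix x assume x: "x \<in> M (Suc l) \<inter> N (Suc r)"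
      obtain a b where ab: "a \<in> N r" "b \<in> N (Suc r) \<inter> M l" "x = a + b"
        using irred_sq_decompose[OF comp_series_irred[OF N r] invariant_Int[OF invN(1) invM(2)] _ not]
          x by blast
      have "x - b \<in> M (Suc l)"
        using x ab MM by (intro inv_subspace(5)[OF invM(1)]) auto
      then have "a \<in> M l"
        using ab meets by (auto simp: meets_def)
      then show "x \<in> M l"
        using ab inv_subspace(2)[OF invM(2)] by auto
    qed
    then show False using meets by (simp add: meets_def)
  qed
qed

lemma meets_sym:
  assumes "comp_series T U W M n" "comp_series T U W N n'" "invariant T U"
    and "l < n" "r < n'" "meets M N l r"
  shows "meets N M r l"
  using meets_facts[OF assms] by (auto simp: meets_def)

text \<open>Both factors are quotients of \<open>M (Suc l) \<inter> N (Suc r)\<close>, and its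
  intersections with \<open>M l\<close> and with \<open>N r\<close>, the two kernels,
  coincide.\<close>

lemma meets_iso:
  assumes M: "comp_series T U W M n" and N: "comp_series T U W N n'" and U: "invariant T U"
    and l: "l < n" and r: "r < n'" and meets: "meets M N l r"
  shows "iso_sq T (M (Suc l)) (M l) (N (Suc r)) (N r)"
proof -
  let ?X = "M (Suc l) \<inter> N (Suc r)"
  have invM: "invariant T (M (Suc l))" "invariant T (M l)"
    using comp_series_invariant[OF M U] l by auto
  have invN: "invariant T (N (Suc r))" "invariant T (N r)"
    using comp_series_invariant[OF N U] r by auto
  have X: "invariant T ?X"
    using invM invN by (simp add: invariant_Int)
  have MM: "M l \<subseteq> M (Suc l)" and NN: "N r \<subseteq> N (Suc r)"
    using comp_series_irred[OF M l] comp_series_irred[OF N r] by (auto simp: irred_sq_def)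
  note facts = meets_facts[OF assms]
  have "?X \<inter> M l = ?X \<inter> N r"
    using facts(2) meets MM NN by (auto simp: meets_def)
  moreover have "iso_sq T ?X (?X \<inter> M l) (M (Suc l)) (M l)"
    using meets by (intro irred_sq_iso_Int comp_series_irred[OF M l] X) (auto simp: meets_def)
  then have "iso_sq T (M (Suc l)) (M l) ?X (?X \<inter> M l)"
    by (rule iso_sq_sym) (use X invM invariant_Int in auto)
  moreover have "iso_sq T ?X (?X \<inter> N r) (N (Suc r)) (N r)"
    using facts(1) by (intro irred_sq_iso_Int comp_series_irred[OF N r] X) auto
  ultimately show ?thesis
    using iso_sq_trans[OF _ _ invM(1) X invariantD(1)[OF invN(2)]] by metis
qed

text \<open>As \<open>meets\<close> is symmetric and either index determines the other, the choice
  functions in the two directions are mutually inverse; equality of the lengths is read off from the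
  bijection.\<close>

theorem jordan_hoelder:
  assumes M: "comp_series T U W M n" and N: "comp_series T U W N n'" and U: "invariant T U"
  obtains \<sigma> where "n = n'" "bij_betw \<sigma> {..<n} {..<n'}"
    "\<And>l. l < n \<Longrightarrow> iso_sq T (M (Suc l)) (M l) (N (Suc (\<sigma> l))) (N (\<sigma> l))"
proof -
  obtain \<sigma> where \<sigma>: "\<And>l. l < n \<Longrightarrow> \<sigma> l < n' \<and> meets M N l (\<sigma> l)"
    using meets_ex[OF M N] by metis
  obtain \<tau> where \<tau>: "\<And>r. r < n' \<Longrightarrow> \<tau> r < n \<and> meets N M r (\<tau> r)"
    using meets_ex[OF N M] by metis
  have "bij_betw \<sigma> {..<n} {..<n'}"
  proof (rule bij_betw_byWitness[where f' = \<tau>])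
    show "\<forall>l\<in>{..<n}. \<tau> (\<sigma> l) = l"
      using meets_sym[OF M N U] meets_unique[OF M] \<sigma> \<tau> by (metis lessThan_iff)
    show "\<forall>r\<in>{..<n'}. \<sigma> (\<tau> r) = r"
      using meets_sym[OF N M U] meets_unique[OF N] \<sigma> \<tau> by (metis lessThan_iff)
  qed (use \<sigma> \<tau> in auto)
  moreover from this have "n = n'"
    using bij_betw_same_card by fastforce
  ultimately show ?thesis
    using that[of \<sigma>] meets_iso[OF M N U] \<sigma> by blast
qed

subsection \<open>Semisimplicity\<close>

text \<open>A complement \<open>Y\<close> of \<open>X\<close> is built by adding one summand at a
  time while \<open>X \<inter> Y\<close> stays inside \<open>W\<close>. A summand not inside
  \<open>X + Y\<close> meets it only in \<open>W\<close>, by irreducibility, and may be added; in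
  the end \<open>X + Y\<close> contains all summands, hence \<open>U\<close>.\<close>

theorem direct_sum_imp_semisimple:
  assumes ds: "direct_sum_sq T U W I V" and irr: "\<And>j. j \<in> I \<Longrightarrow> irred_sq T (V j) W"
    and U: "invariant T U" and W: "invariant T W" and WU: "W \<subseteq> U"
  shows "semisimple_sq T U W"
  unfolding semisimple_sq_def
proof (intro conjI allI impI U W WU)
  fix X assume X: "invariant T X \<and> W \<subseteq> X \<and> X \<subseteq> U"
  have fin: "finite I" and VI: "\<And>j. j \<in> I \<Longrightarrow> invariant T (V j) \<and> W \<subseteq> V j \<and> V j \<subseteq> U"
    and span: "\<And>x. x \<in> U \<Longrightarrow> \<exists>f. (\<forall>j\<in>I. f j \<in> V j) \<and> x - (\<Sum>j\<in>I. f j) \<in> W"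
    using ds by (auto simp: direct_sum_sq_def)
  have "\<exists>Y. invariant T Y \<and> W \<subseteq> Y \<and> Y \<subseteq> U \<and> X \<inter> Y \<subseteq> W \<and> (\<forall>j\<in>J. V j \<subseteq> set_plus X Y)"
    if "J \<subseteq> I" for J
    using finite_subset[OF that fin] that
  proof (induction J rule: finite_induct)
    case empty
    show ?case using W WU by (intro exI[of _ W]) auto
  next
    case (insert j J)
    then obtain Y where Y: "invariant T Y" "W \<subseteq> Y" "Y \<subseteq> U" "X \<inter> Y \<subseteq> W"
      "\<forall>j\<in>J. V j \<subseteq> set_plus X Y" by auto
    have j: "j \<in> I" using insert by auto
    have invXY: "invariant T (set_plus X Y)"
      using X Y invariant_set_plus by blast
    show ?case
    proof (cases "V j \<subseteq> set_plus X Y")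
      case True
      then show ?thesis using Y by (intro exI[of _ Y]) auto
    next
      case False
      have "W \<subseteq> set_plus X Y"
        using X Y subset_set_plus1[of Y X] invariantD by blast
      then have Vint: "V j \<inter> set_plus X Y = W"
        using irr[OF j] VI[OF j] False invariant_Int[OF _ invXY, of "V j"]
        unfolding irred_sq_def by blast
      let ?Y = "set_plus (V j) Y"
      have sub: "V j \<subseteq> ?Y" "Y \<subseteq> ?Y"
        using subset_set_plus1 subset_set_plus2 VI[OF j] Y invariantD(1) by metis+
      have "X \<inter> ?Y \<subseteq> W"
      proof
        fix x assume x: "x \<in> X \<inter> ?Y"
        then obtain a b where ab: "a \<in> V j" "b \<in> Y" "x = a + b" by (auto elim!: set_plusE)
        have "x + - b \<in> set_plus X Y"
          using x ab Y inv_subspace(4) by (intro set_plusI) auto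
        then have "a \<in> W" using ab Vint by auto
        then have "x \<in> Y" using ab Y inv_subspace(2)[OF Y(1)] by auto
        then show "x \<in> W" using x Y by auto
      qed
      moreover have "V i \<subseteq> set_plus X ?Y" if i: "i \<in> insert j J" for i
      proof (cases "i = j")
        case True
        then show ?thesis
          using sub(1) subset_set_plus2[of X ?Y] X invariantD(1) by blast
      next
        case False
        then have "V i \<subseteq> set_plus X Y" using Y i by auto
        also have "\<dots> \<subseteq> set_plus X ?Y"
          using sub(2) unfolding set_plus_def by blast
        finally show ?thesis .
      qed
      moreover have "invariant T ?Y" "W \<subseteq> ?Y" "?Y \<subseteq> U"
        using invariant_set_plus VI[OF j] Y sub set_plus_subset[OF invariantD(1)[OF U]] by blast+
      ultimately show ?thesis by blast
    qed
  qed
  from this[OF order_refl] obtain Y where Y: "invariant T Y" "W \<subseteq> Y" "Y \<subseteq> U" "X \<inter> Y \<subseteq> W"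
    "\<forall>j\<in>I. V j \<subseteq> set_plus X Y" by auto
  have XY: "lsubspace (set_plus X Y)"
    using X Y lsubspace_set_plus invariantD(1) by blast
  have "U \<subseteq> set_plus X Y"
  proof
    fix x assume "x \<in> U"
    then obtain f where f: "\<forall>j\<in>I. f j \<in> V j" "x - (\<Sum>j\<in>I. f j) \<in> W" using span by blast
    have "(\<Sum>j\<in>I. f j) \<in> set_plus X Y"
      using f(1) Y(5) by (intro lsubspace_sum[OF XY]) blast
    moreover have "x - (\<Sum>j\<in>I. f j) \<in> set_plus X Y"
      using f X Y subset_set_plus1[OF invariantD(1)[OF Y(1)], of X] by blast
    ultimately have "(x - (\<Sum>j\<in>I. f j)) + (\<Sum>j\<in>I. f j) \<in> set_plus X Y"
      by (intro lsubspaceD(2)[OF XY])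
    then show "x \<in> set_plus X Y" by simp
  qed
  then have "\<forall>x\<in>U. \<exists>a\<in>X. \<exists>b\<in>Y. x = a + b"
    by (blast elim: set_plusE)
  then show "\<exists>V'. invariant T V' \<and> W \<subseteq> V' \<and> V' \<subseteq> U \<and> X \<inter> V' = W \<and>
      (\<forall>x\<in>U. \<exists>a\<in>X. \<exists>b\<in>V'. x = a + b)"
    using X Y by (intro exI[of _ Y]) auto
qed

end

section \<open>Polynomials divisible by a product of prime powers\<close>

definition coeffs_dvd :: "'a::field_gcd poly \<Rightarrow> 'a poly poly set" where
  "coeffs_dvd d = {p. \<forall>c. d dvd coeff p c}"

lemma coeffs_dvd_iff: "p \<in> coeffs_dvd d \<longleftrightarrow> (\<forall>c. d dvd coeff p c)"
  by (simp add: coeffs_dvd_def)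

lemma monom_in_coeffs_dvd: "d dvd a \<Longrightarrow> monom a n \<in> coeffs_dvd d"
  by (simp add: coeffs_dvd_iff)

lemma lsubspace_coeffs_dvd: "lsubspace (coeffs_dvd d)"
  by (simp add: lsubspace_def coeffs_dvd_iff dvd_smult)

lemma dvd_cong_iff: "d dvd a - b \<Longrightarrow> d dvd a \<longleftrightarrow> d dvd b" for a b d :: "'a::comm_ring_1"
  using dvd_add_right_iff[of d "a - b" b] by simp

lemma coeffs_dvd_mono: "d' dvd d \<Longrightarrow> coeffs_dvd d \<subseteq> coeffs_dvd d'"
  unfolding coeffs_dvd_iff subset_iff using dvd_trans by blast

text \<open>Characteristic 0 in the form in which the weights use it: a prime \<open>u j\<close>
  divides an integer weight only if that weight is 0.\<close>

lemma is_unit_of_int_poly: "s \<noteq> 0 \<Longrightarrow> is_unit (of_int s :: 'a::{field_char_0,field_gcd} poly)"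
  by (simp add: of_int_poly is_unit_pCons_iff)

locale factored_poly =
  fixes u :: "nat \<Rightarrow> 'a::{field_char_0,field_gcd} poly" and \<alpha> :: "nat \<Rightarrow> nat" and t k :: nat
  assumes u_irr: "\<forall>j<t. lead_coeff (u j) = 1 \<and> irreducible (u j)"
    and u_dist: "inj_on u {..<t}"
    and k_pos: "1 \<le> k" and k_le: "k \<le> t"
    and \<alpha>_big: "\<forall>j<k. 2 \<le> \<alpha> j" and \<alpha>_one: "\<forall>j. k \<le> j \<and> j < t \<longrightarrow> \<alpha> j = 1"
begin

lemma u_prime: "j < t \<Longrightarrow> prime (u j)"
  using u_irr by (auto simp: prime_def irreducible_imp_prime_elem_gcd intro!: poly_eqI)

lemma u_prime_elem: "j < t \<Longrightarrow> prime_elem (u j)"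
  using u_prime prime_def by blast

lemma u_nonzero: "j < t \<Longrightarrow> u j \<noteq> 0"
  using u_prime by fastforce

lemma u_degree: "j < t \<Longrightarrow> 0 < degree (u j)"
  using u_irr is_unit_iff_degree[OF u_nonzero] by (metis gr0I irreducible_def)

lemma u_dvd_mult_iff: "j < t \<Longrightarrow> u j dvd a * b \<longleftrightarrow> u j dvd a \<or> u j dvd b"
  using prime_elem_dvd_mult_iff[OF u_prime_elem] .

lemma u_dvd_u_iff: "j < t \<Longrightarrow> l < t \<Longrightarrow> u j dvd u l \<longleftrightarrow> j = l"
  using primes_dvd_imp_eq[OF u_prime u_prime] u_dist by (auto dest: inj_onD)

lemma u_coprime: "j < t \<Longrightarrow> l < t \<Longrightarrow> j \<noteq> l \<Longrightarrow> coprime (u j) (u l)"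
  using primes_coprime[OF u_prime u_prime] u_dist by (auto dest: inj_onD)

lemma u_not_dvd_1: "j < t \<Longrightarrow> \<not> u j dvd 1"
  using u_prime_elem prime_elem_not_unit by blast

lemma u_inverse:
  assumes "j < t" "\<not> u j dvd a"
  obtains b where "u j dvd a * b - 1"
proof -
  have "coprime (u j) a"
    using assms by (intro prime_elem_imp_coprime u_prime_elem)
  then have "fst (bezout_coefficients (u j) a) * u j + snd (bezout_coefficients (u j) a) * a = 1"
    by (simp add: bezout_coefficients_fst_snd)
  then have "a * snd (bezout_coefficients (u j) a) - 1 = u j * - fst (bezout_coefficients (u j) a)"
    by (simp add: algebra_simps)
  then show ?thesis using that by (metis dvd_triv_left)
qed

lemma u_pow_dvd_mult_iff:
  assumes "j < t" "\<not> u j dvd a"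
  shows "u j ^ n dvd a * b \<longleftrightarrow> u j ^ n dvd b"
proof -
  have "coprime (u j ^ n) a"
    using assms prime_elem_imp_coprime[OF u_prime_elem] by simp
  then show ?thesis by (rule coprime_dvd_mult_right_iff)
qed

lemma prod_pow_dvd_iff:
  assumes "S \<subseteq> {..<t}"
  shows "(\<Prod>j\<in>S. u j ^ \<beta> j) dvd p \<longleftrightarrow> (\<forall>j\<in>S. u j ^ \<beta> j dvd p)"
  using finite_subset[OF assms finite_lessThan] assms
proof (induction S rule: finite_induct)
  case (insert j S)
  have "coprime (u j ^ \<beta> j) (\<Prod>l\<in>S. u l ^ \<beta> l)"
    using insert by (intro prod_coprime_right) (auto intro!: u_coprime)
  then have "u j ^ \<beta> j * (\<Prod>l\<in>S. u l ^ \<beta> l) dvd p \<longleftrightarrow>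
      u j ^ \<beta> j dvd p \<and> (\<Prod>l\<in>S. u l ^ \<beta> l) dvd p"
    by (metis divides_mult dvd_mult_left dvd_mult_right)
  with insert show ?case by simp
qed simp

lemma u_not_dvd_prod_pow:
  assumes "j < t" "S \<subseteq> {..<t}" "j \<notin> S"
  shows "\<not> u j dvd (\<Prod>l\<in>S. u l ^ \<beta> l)"
proof
  assume "u j dvd (\<Prod>l\<in>S. u l ^ \<beta> l)"
  moreover have "finite S"
    using assms(2) finite_subset by blast
  ultimately obtain l where "l \<in> S" "u j dvd u l ^ \<beta> l"
    using prime_dvd_prod_iff[of S "u j" "\<lambda>l. u l ^ \<beta> l"] u_prime[OF assms(1)] by auto
  then have "u j dvd u l" using prime_elem_dvd_power[OF u_prime_elem[OF assms(1)]] by blast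
  then show False using assms \<open>l \<in> S\<close> u_dvd_u_iff by (metis lessThan_iff subsetD)
qed

definition upow :: "(nat \<Rightarrow> nat) \<Rightarrow> 'a poly" where
  "upow \<beta> = (\<Prod>j<k. u j ^ \<beta> j)"

lemma upow_dvd_iff: "upow \<beta> dvd p \<longleftrightarrow> (\<forall>j<k. u j ^ \<beta> j dvd p)"
  using prod_pow_dvd_iff[of "{..<k}"] k_le unfolding upow_def by auto

lemma upow_nonzero: "upow \<beta> \<noteq> 0"
  using u_nonzero k_le by (auto simp: upow_def)

lemma upow_Suc:
  assumes "j < k"
  shows "upow (\<beta>(j := Suc (\<beta> j))) = u j * upow \<beta>"
proof -
  have "upow \<gamma> = u j ^ \<gamma> j * (\<Prod>l\<in>{..<k} - {j}. u l ^ \<gamma> l)" for \<gamma>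
    unfolding upow_def using assms by (intro prod.remove) auto
  then show ?thesis by simp
qed

section \<open>Logarithmic derivatives and congruences modulo a single prime\<close>

text \<open>This is \<open>piH\<close> times the logarithmic derivative of \<open>u j\<close>,
  written without division: a unit modulo \<open>u j\<close> and zero modulo every other
  prime.\<close>

definition kap :: "nat \<Rightarrow> 'a poly" where
  "kap j = pderiv (u j) * (\<Prod>l\<in>{..<t} - {j}. u l)"

abbreviation "pih \<equiv> piH u t"
abbreviation "ch \<equiv> cH u \<alpha> t"

lemma pih_split: "j < t \<Longrightarrow> pih = u j * (\<Prod>l\<in>{..<t} - {j}. u l)"
  unfolding piH_def by (intro prod.remove) auto

lemma u_dvd_pih: "j < t \<Longrightarrow> u j dvd pih"
  using pih_split by simp

lemma u_dvd_kap: "j < t \<Longrightarrow> l < t \<Longrightarrow> l \<noteq> j \<Longrightarrow> u j dvd kap l"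
  unfolding kap_def by (intro dvd_mult dvd_prodI) auto

text \<open>In characteristic 0 the derivative of \<open>u j\<close> is nonzero and of too small a
  degree to be divisible by \<open>u j\<close>; the cofactor consists of other primes.\<close>

lemma u_not_dvd_kap:
  assumes "j < t"
  shows "\<not> u j dvd kap j"
proof -
  have "\<not> u j dvd pderiv (u j)"
  proof
    assume "u j dvd pderiv (u j)"
    moreover have "pderiv (u j) \<noteq> 0" "degree (pderiv (u j)) < degree (u j)"
      using u_degree[OF assms] by (auto simp: pderiv_eq_0_iff degree_pderiv)
    ultimately show False using dvd_imp_degree_le by (metis not_less)
  qed
  moreover have "\<not> u j dvd (\<Prod>l\<in>{..<t} - {j}. u l)"
    using u_not_dvd_prod_pow[of j "{..<t} - {j}" "\<lambda>_. 1"] assms by auto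
  ultimately show ?thesis
    unfolding kap_def using u_dvd_mult_iff assms by blast
qed

lemma pih_pderiv_prod_pow:
  assumes "S \<subseteq> {..<t}"
  shows "pih * pderiv (\<Prod>j\<in>S. u j ^ \<beta> j) = (\<Prod>j\<in>S. u j ^ \<beta> j) * (\<Sum>j\<in>S. of_nat (\<beta> j) * kap j)"
  using finite_subset[OF assms finite_lessThan] assms
proof (induction S rule: finite_induct)
  case (insert j S)
  let ?Q = "\<Prod>l\<in>S. u l ^ \<beta> l" and ?s = "\<Sum>l\<in>S. of_nat (\<beta> l) * kap l"
  have pow: "pih * pderiv (u j ^ b) = u j ^ b * (of_nat b * kap j)" for b
  proof (cases b)
    case (Suc m)
    then show ?thesis
      using pih_split[of j] insert.prems
      by (simp add: pderiv_power_Suc kap_def of_nat_poly del: power_Suc of_nat_Suc) (simp add: algebra_simps)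
  qed simp
  have "pih * pderiv (u j ^ \<beta> j * ?Q) = u j ^ \<beta> j * (pih * pderiv ?Q) + ?Q * (pih * pderiv (u j ^ \<beta> j))"
    by (simp add: pderiv_mult algebra_simps)
  also have "\<dots> = u j ^ \<beta> j * (?Q * ?s) + ?Q * (u j ^ \<beta> j * (of_nat (\<beta> j) * kap j))"
    using insert by (simp add: pow)
  finally show ?case
    using insert by (simp add: algebra_simps)
qed simp

lemma hP_nonzero: "hP u \<alpha> t \<noteq> 0"
  using u_nonzero by (auto simp: hP_def)

lemma pih_pderiv_hP: "pih * pderiv (hP u \<alpha> t) = hP u \<alpha> t * (\<Sum>j<t. of_nat (\<alpha> j) * kap j)"
  using pih_pderiv_prod_pow[of "{..<t}" \<alpha>] by (simp add: hP_def)

lemma ch_eq: "ch = (\<Sum>j<t. of_nat (\<alpha> j) * kap j)"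
  using hP_nonzero by (simp add: cH_def pih_pderiv_hP)

lemma pderiv_pih: "pderiv pih = (\<Sum>j<t. kap j)"
  by (simp add: piH_def pderiv_prod kap_def mult.commute)

lemma u_dvd_sum_diff:
  assumes "j \<in> S" "S \<subseteq> {..<t}"
  shows "u j dvd (\<Sum>l\<in>S. of_nat (b l) * kap l) - of_nat (b j) * kap j"
proof -
  have "finite S" using assms finite_subset by blast
  then have "(\<Sum>l\<in>S. of_nat (b l) * kap l) - of_nat (b j) * kap j =
      (\<Sum>l\<in>S - {j}. of_nat (b l) * kap l)"
    using assms by (simp add: sum.remove[of S j])
  also have "u j dvd \<dots>"
    using assms by (intro dvd_sum dvd_mult u_dvd_kap) auto
  finally show ?thesis .
qed

lemma ch_cong: "j < t \<Longrightarrow> u j dvd ch - of_nat (\<alpha> j) * kap j"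
  unfolding ch_eq by (rule u_dvd_sum_diff) auto

lemma pderiv_pih_cong: "j < t \<Longrightarrow> u j dvd pderiv pih - kap j"
  using u_dvd_sum_diff[of j "{..<t}" "\<lambda>_. 1"] by (simp add: pderiv_pih)

lemma delta0_eq: "delta0 u \<alpha> t g = pderiv g * pih + g * (pderiv pih - ch)"
  by (simp add: delta0_def pderiv_mult algebra_simps)

section \<open>The action on monomials\<close>

definition act :: "'a poly \<Rightarrow> nat \<Rightarrow> nat \<Rightarrow> 'a poly \<Rightarrow> 'a poly" where
  "act g n l q = of_nat n * pih * g * pderiv q - of_nat n * g * ch * q - of_nat l * delta0 u \<alpha> t g * q"

lemma act_0 [simp]: "act g n l 0 = 0"
  by (simp add: act_def)

lemma act_0_0 [simp]: "act g 0 0 q = 0"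
  by (simp add: act_def)

lemma act_add: "act g n l (p + q) = act g n l p + act g n l q"
  by (simp add: act_def pderiv_add algebra_simps)

lemma act_smult: "act g n l (smult c q) = smult c (act g n l q)"
  by (simp add: act_def pderiv_smult smult_diff_right)

lemma coeff_Top: "coeff (Top u \<alpha> t g n p) c =
    (if n \<le> Suc c then act g n (Suc c - n) (coeff p (Suc c - n)) else 0)"
proof -
  \<comment> \<open>The exponent n + l - 1 is truncated only for n = l = 0, where \<open>act\<close>
    vanishes, so the condition may be replaced by the untruncated n + l = c + 1.\<close>
  have shift: "(if n + l - 1 = c then act g n l q else 0) = (if n + l = Suc c then act g n l q else 0)" for l q
  proof (cases "n + l = 0")
    case False
    then have "n + l - 1 = c \<longleftrightarrow> n + l = Suc c" by linarith
    then show ?thesis by simp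
  qed simp
  have "coeff (Top u \<alpha> t g n p) c =
      (\<Sum>l\<le>degree p. if n + l - 1 = c then act g n l (coeff p l) else 0)"
    unfolding Top_def coeff_sum coeff_monom act_def ..
  also have "\<dots> = (\<Sum>l\<le>degree p. if n + l = Suc c then act g n l (coeff p l) else 0)"
    by (simp only: shift)
  also have "\<dots> = (if n \<le> Suc c then act g n (Suc c - n) (coeff p (Suc c - n)) else 0)"
  proof (cases "n \<le> Suc c")
    case True
    then have "n + l = Suc c \<longleftrightarrow> l = Suc c - n" for l by auto
    with True show ?thesis by (simp add: coeff_eq_0)
  qed (auto intro!: sum.neutral)
  finally show ?thesis .
qed

lemma Top_monom: "Top u \<alpha> t g n (monom q l) = monom (act g n l q) (n + l - 1)"
proof (rule poly_eqI)
  show "coeff (Top u \<alpha> t g n (monom q l)) c = coeff (monom (act g n l q) (n + l - 1)) c" for c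
    by (cases "n + l = 0") (auto simp: coeff_Top)
qed

sublocale linear_operators "Top u \<alpha> t"
proof
  show "Top u \<alpha> t g n (x + y) = Top u \<alpha> t g n x + Top u \<alpha> t g n y" for g n x y
    by (rule poly_eqI) (simp add: coeff_Top act_add)
  show "Top u \<alpha> t g n (smult [:c:] x) = smult [:c:] (Top u \<alpha> t g n x)" for g n c x
    by (rule poly_eqI) (simp add: coeff_Top act_smult)
qed

text \<open>The derivative of \<open>upow \<beta>\<close>, multiplied by \<open>piH\<close>, is
  again a multiple of \<open>upow \<beta>\<close>. Hence it factors out of the action, which makes
  \<open>coeffs_dvd (upow \<beta>)\<close> invariant.\<close>

lemma act_upow:
  "act g n l (upow \<beta> * q) = upow \<beta> * (of_nat n * g * (pih * pderiv q + (\<Sum>j<k. of_nat (\<beta> j) * kap j) * q)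
      - of_nat n * g * ch * q - of_nat l * delta0 u \<alpha> t g * q)"
proof -
  have "pih * pderiv (upow \<beta> * q) = upow \<beta> * (pih * pderiv q) + q * (pih * pderiv (upow \<beta>))"
    by (simp add: pderiv_mult algebra_simps)
  also have "pih * pderiv (upow \<beta>) = upow \<beta> * (\<Sum>j<k. of_nat (\<beta> j) * kap j)"
    unfolding upow_def using k_le by (intro pih_pderiv_prod_pow) auto
  finally have "pih * pderiv (upow \<beta> * q) = upow \<beta> * (pih * pderiv q + (\<Sum>j<k. of_nat (\<beta> j) * kap j) * q)"
    by (simp add: algebra_simps)
  then show ?thesis
    unfolding act_def by (simp add: algebra_simps)
qed

lemma upow_dvd_act: "upow \<beta> dvd q \<Longrightarrow> upow \<beta> dvd act g n l q"
  by (auto simp: act_upow elim!: dvdE)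

lemma invariant_upow: "invariant (Top u \<alpha> t) (coeffs_dvd (upow \<beta>))"
  by (auto simp: invariant_def lsubspace_coeffs_dvd coeffs_dvd_iff coeff_Top upow_dvd_act)

text \<open>For \<open>\<beta> j = i\<close> this is \<open>\<alpha> j - 1\<close> times
  \<open>l - n * \<mu>\<close> with \<mu> = (\<alpha> j - i) / (\<alpha> j - 1). Clearing the
  denominator leaves an integer, which is a unit unless it is 0.\<close>

definition wt :: "(nat \<Rightarrow> nat) \<Rightarrow> nat \<Rightarrow> nat \<Rightarrow> nat \<Rightarrow> int" where
  "wt \<beta> j n l = int l * (int (\<alpha> j) - 1) - int n * (int (\<alpha> j) - int (\<beta> j))"

text \<open>On the subquotient between \<open>u\<^sub>j\<close> times \<open>upow \<beta>\<close> and \<open>upow \<beta>\<close> the derivative terms disappear,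
  and \<open>g a\<^sub>n\<close> acts on degree \<open>l\<close> as multiplication by \<open>g\<close>, the unit \<open>kap j\<close> and an integer.\<close>

lemma act_cong:
  assumes j: "j < k"
  shows "u j * upow \<beta> dvd act g n l (upow \<beta> * q) - upow \<beta> * (of_int (wt \<beta> j n l) * (q * g * kap j))"
proof -
  let ?L = "\<Sum>l<k. of_nat (\<beta> l) * kap l"
  have jt: "j < t" using j k_le by simp
  \<comment> \<open>All that is discarded modulo \<open>u j\<close>: the terms containing
    \<open>pih\<close>, and the errors made when \<open>?L\<close>, \<open>ch\<close> and the
    derivative of \<open>pih\<close> are replaced by their multiples of
    \<open>kap j\<close>.\<close>
  have "u j dvd of_nat n * g * pih * pderiv q + of_nat n * g * q * (?L - of_nat (\<beta> j) * kap j)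
      - of_nat n * g * q * (ch - of_nat (\<alpha> j) * kap j)
      - of_nat l * pderiv g * pih * q - of_nat l * g * q * (pderiv pih - kap j)
      + of_nat l * g * q * (ch - of_nat (\<alpha> j) * kap j)"
    using u_dvd_sum_diff[of j "{..<k}" \<beta>] ch_cong[OF jt] pderiv_pih_cong[OF jt] u_dvd_pih[OF jt] j k_le
    by (intro dvd_add dvd_diff) (auto intro: dvd_mult dvd_mult2)
  also have "\<dots> = of_nat n * g * (pih * pderiv q + ?L * q)
      - of_nat n * g * ch * q - of_nat l * delta0 u \<alpha> t g * q - of_int (wt \<beta> j n l) * (q * g * kap j)"
    by (simp add: delta0_eq wt_def algebra_simps)
  finally have "upow \<beta> * u j dvd upow \<beta> * \<dots>"
    by (rule mult_dvd_mono[OF dvd_refl])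
  then show ?thesis
    unfolding act_upow right_diff_distrib by (simp add: mult.commute)
qed

abbreviation "T \<equiv> Top u \<alpha> t"

lemma dvd_upow_mult_iff: "u j * upow \<beta> dvd upow \<beta> * q \<longleftrightarrow> u j dvd q"
  using upow_nonzero by (simp add: mult.commute[of "u j"])

text \<open>By \<open>act_cong\<close> the result is a product of the weight, \<open>g\<close>,
  \<open>kap j\<close> and the cofactor of \<open>p\<close>. The prime \<open>u j\<close> divides
  neither \<open>kap j\<close> nor a nonzero integer.\<close>

lemma act_dvd_iff:
  assumes "j < k" "upow \<beta> dvd p"
  shows "u j * upow \<beta> dvd act g n l p \<longleftrightarrow> wt \<beta> j n l = 0 \<or> u j dvd g \<or> u j * upow \<beta> dvd p"
proof -
  obtain q where q: "p = upow \<beta> * q" using assms by (elim dvdE)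
  have jt: "j < t" using assms k_le by simp
  have "u j * upow \<beta> dvd act g n l p \<longleftrightarrow> u j dvd of_int (wt \<beta> j n l) * (q * g * kap j)"
    using dvd_cong_iff[OF act_cong[OF assms(1), of \<beta> g n l q]] dvd_upow_mult_iff q by simp
  also have "\<dots> \<longleftrightarrow> wt \<beta> j n l = 0 \<or> u j dvd g \<or> u j dvd q"
    using u_not_dvd_kap[OF jt] is_unit_of_int_poly[of "wt \<beta> j n l"] u_prime_elem[OF jt]
    by (auto simp: u_dvd_mult_iff[OF jt] dest: dvd_unit_imp_unit prime_elem_not_unit)
  finally show ?thesis by (simp add: q dvd_upow_mult_iff)
qed

lemma upow_Suc':
  assumes "j < k"
  shows "upow (\<beta>(j := Suc (\<beta> j))) = u j * upow \<beta>" "invariant T (coeffs_dvd (u j * upow \<beta>))"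
  using upow_Suc[OF assms, of \<beta>] invariant_upow by metis+

lemma wt_0_Suc: "j < k \<Longrightarrow> wt \<beta> j 0 (Suc l) \<noteq> 0"
  using \<alpha>_big by (fastforce simp: wt_def)

lemma wt_Suc_0: "\<beta> j < \<alpha> j \<Longrightarrow> wt \<beta> j (Suc n) 0 \<noteq> 0"
  by (auto simp: wt_def)

text \<open>Irreducibility: a nonzero element is moved down to degree 0 by \<open>T 1 0\<close>, and the operators
  \<open>T g (s + 1)\<close> produce everything from there.\<close>

lemma irred_upow:
  assumes j: "j < k" and \<beta>: "\<beta> j < \<alpha> j"
  shows "irred_sq T (coeffs_dvd (upow \<beta>)) (coeffs_dvd (u j * upow \<beta>))"
  unfolding irred_sq_def
proof (intro conjI allI impI)
  let ?d = "upow \<beta>"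
  let ?U = "coeffs_dvd ?d" and ?W = "coeffs_dvd (u j * ?d)"
  have jt: "j < t" using j k_le by simp
  show "invariant T ?U" "invariant T ?W"
    using invariant_upow upow_Suc'(2)[OF j] by auto
  have "monom ?d 0 \<in> ?U" "monom ?d 0 \<notin> ?W"
    using dvd_upow_mult_iff[of j \<beta> 1] u_not_dvd_1[OF jt] by (auto simp: coeffs_dvd_iff)
  then show "?W \<subset> ?U"
    using coeffs_dvd_mono[of ?d "u j * ?d"] by auto
  fix V assume V: "invariant T V \<and> ?W \<subseteq> V \<and> V \<subseteq> ?U"
  then have VI: "invariant T V" and WV: "?W \<subseteq> V" and VU: "V \<subseteq> ?U" by auto
  note sub = inv_subspace[OF VI]
  \<comment> \<open>\<open>N\<close> is the degree of \<open>x\<close> modulo \<open>?W\<close>,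
    which may be lower than the degree of \<open>x\<close> itself.\<close>
  define top_at where "top_at N x \<longleftrightarrow> x \<in> V \<and> \<not> u j * ?d dvd coeff x N \<and> (\<forall>c>N. u j * ?d dvd coeff x c)" for N x
  have descend: "\<exists>x. top_at 0 x" if "top_at N x" for N x
    using that
  proof (induction N arbitrary: x)
    case (Suc N)
    have x: "\<forall>c. ?d dvd coeff x c"
      using Suc.prems VU by (auto simp: top_at_def coeffs_dvd_iff)
    have "u j * ?d dvd coeff (T 1 0 x) c \<longleftrightarrow> u j * ?d dvd coeff x (Suc c)" for c
      using act_dvd_iff[OF j, of \<beta> "coeff x (Suc c)" 1 0 "Suc c"] x wt_0_Suc[OF j] u_not_dvd_1[OF jt]
      by (simp add: coeff_Top)
    then have "top_at N (T 1 0 x)"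
      using Suc.prems invariantD(2)[OF VI] by (auto simp: top_at_def)
    then show ?case by (rule Suc.IH)
  qed blast
  show "V = ?W \<or> V = ?U"
  proof (rule disjCI)
    assume "V \<noteq> ?U"
    have False if "x \<in> V" "x \<notin> ?W" for x
    proof -
      let ?C = "{c. \<not> u j * ?d dvd coeff x c}"
      have "c \<le> degree x" if "\<not> u j * ?d dvd coeff x c" for c
        using that coeff_eq_0[of x c] by (cases "c \<le> degree x") auto
      then have "?C \<subseteq> {..degree x}" by auto
      then have "finite ?C" "?C \<noteq> {}"
        using finite_subset that by (auto simp: coeffs_dvd_iff)
      then have "\<not> u j * ?d dvd coeff x (Max ?C)" and "c \<le> Max ?C" if "\<not> u j * ?d dvd coeff x c" for c
        using Max_in[of ?C] Max_ge[of ?C c] that by auto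
      then have "top_at (Max ?C) x"
        using that by (meson coeffs_dvd_iff not_less top_at_def)
      then obtain y where y: "top_at 0 y" using descend by blast
      then have "y \<in> ?U" using VU by (auto simp: top_at_def)
      then obtain q where q: "coeff y 0 = ?d * q" by (auto simp: coeffs_dvd_iff elim: dvdE)
      have uq: "\<not> u j dvd q"
        using y dvd_upow_mult_iff[of j \<beta> q] by (simp add: top_at_def q)
      \<comment> \<open>After the descent \<open>y\<close> equals its constant term modulo
        \<open>?W\<close>, so this term alone lies in \<open>V\<close>.\<close>
      have "y - monom (?d * q) 0 \<in> ?W"
        using y by (auto simp: coeffs_dvd_iff top_at_def q[symmetric] coeff_monom)
      then have low: "monom (?d * q) 0 \<in> V"
        using sub(5)[of y "y - monom (?d * q) 0"] y WV by (auto simp: top_at_def)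
      obtain b where b: "u j dvd q * kap j * b - 1"
        using u_inverse[OF jt, of "q * kap j"] uq u_not_dvd_kap[OF jt] u_dvd_mult_iff[OF jt] by blast
      have gen: "monom (?d * f) s \<in> V" for f s
      proof -
        \<comment> \<open>\<open>g\<close> solves \<open>w * q * g * kap j = f\<close> modulo
          \<open>u j\<close>, as \<open>b\<close> inverts \<open>q * kap j\<close>. So
          \<open>T g (Suc s)\<close> sends the constant term to \<open>?d * f\<close> in degree
          \<open>s\<close>, modulo \<open>?W\<close>.\<close>
        define w where "w = wt \<beta> j (Suc s) 0"
        define g where "g = smult (1 / of_int w) (f * b)"
        have w: "w \<noteq> 0" unfolding w_def by (rule wt_Suc_0) (rule \<beta>)
        have "of_int w * (q * g * kap j) - f = f * (q * kap j * b - 1)"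
          using w by (simp add: g_def of_int_poly algebra_simps)
        then have "u j * ?d dvd ?d * (of_int w * (q * g * kap j) - f)"
          using b by (simp add: dvd_upow_mult_iff)
        then have "u j * ?d dvd (act g (Suc s) 0 (?d * q) - ?d * (of_int w * (q * g * kap j)))
            + ?d * (of_int w * (q * g * kap j) - f)"
          using act_cong[OF j, of \<beta> g "Suc s" 0 q] unfolding w_def by (intro dvd_add)
        also have "\<dots> = act g (Suc s) 0 (?d * q) - ?d * f"
          by (simp add: algebra_simps)
        finally have "monom (act g (Suc s) 0 (?d * q) - ?d * f) s \<in> V"
          using WV monom_in_coeffs_dvd by blast
        moreover have "monom (act g (Suc s) 0 (?d * q)) s \<in> V"
          using invariantD(2)[OF VI low, of g "Suc s"] by (simp add: Top_monom)
        ultimately have "monom (act g (Suc s) 0 (?d * q)) s - monom (act g (Suc s) 0 (?d * q) - ?d * f) s \<in> V"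
          by (intro sub)
        then show ?thesis by (simp add: diff_monom)
      qed
      have "?U \<subseteq> V"
      proof
        fix z assume "z \<in> ?U"
        then have "monom (coeff z c) c \<in> V" for c
          using gen by (auto simp: coeffs_dvd_iff elim!: dvdE[of ?d "coeff z c"] dest!: spec[of _ c])
        then have "(\<Sum>c\<le>degree z. monom (coeff z c) c) \<in> V"
          by (intro lsubspace_sum[OF invariantD(1)[OF VI]])
        then show "z \<in> V" by (simp add: poly_as_sum_of_monoms)
      qed
      with VU \<open>V \<noteq> ?U\<close> show False by blast
    qed
    then show "V = ?W" using WV by blast
  qed
qed

section \<open>Isomorphism types of the one-step subquotients\<close>

text \<open>The inclusion induces the isomorphism. The quotient \<open>R\<close> of the two products
  is prime to \<open>u j\<close>, as the exponents agree at \<open>j\<close>; with \<open>b\<close>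
  an inverse of \<open>R\<close> modulo \<open>u j\<close>, multiplication by \<open>R * b\<close>
  yields preimages. Only the inclusion, not this multiplication, has to respect the
  operators.\<close>

lemma iso_upow_le:
  assumes j: "j < k" and le: "\<And>l. l < k \<Longrightarrow> \<beta> l \<le> \<gamma> l" and eq: "\<beta> j = \<gamma> j"
  shows "iso_sq T (coeffs_dvd (upow \<gamma>)) (coeffs_dvd (u j * upow \<gamma>))
      (coeffs_dvd (upow \<beta>)) (coeffs_dvd (u j * upow \<beta>))"
proof (rule iso_sq_inclusion)
  have jt: "j < t" using j k_le by simp
  define R where "R = (\<Prod>l<k. u l ^ (\<gamma> l - \<beta> l))"
  have R: "upow \<gamma> = R * upow \<beta>"
    using le by (simp add: R_def upow_def flip: prod.distrib power_add)
  have "R = (\<Prod>l\<in>{..<k} - {j}. u l ^ (\<gamma> l - \<beta> l))"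
    unfolding R_def using j eq by (subst prod.remove[of _ j]) auto
  moreover have "{..<k} - {j} \<subseteq> {..<t}"
    using k_le by auto
  ultimately have uR: "\<not> u j dvd R"
    using u_not_dvd_prod_pow[of j "{..<k} - {j}" "\<lambda>l. \<gamma> l - \<beta> l"] jt by simp
  obtain b where b: "u j dvd R * b - 1"
    using u_inverse[OF jt uR] .
  show "lsubspace (coeffs_dvd (u j * upow \<beta>))"
    by (rule lsubspace_coeffs_dvd)
  show "coeffs_dvd (upow \<gamma>) \<subseteq> coeffs_dvd (upow \<beta>)"
    by (rule coeffs_dvd_mono) (simp add: R)
  have "u j * upow \<beta> dvd upow \<gamma> * q \<longleftrightarrow> u j * upow \<gamma> dvd upow \<gamma> * q" for q
  proof -
    have "u j * upow \<beta> dvd upow \<gamma> * q \<longleftrightarrow> u j dvd R * q"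
      using dvd_upow_mult_iff[of j \<beta> "R * q"] by (simp add: R mult_ac)
    then show ?thesis
      using uR by (simp add: u_dvd_mult_iff[OF jt] dvd_upow_mult_iff)
  qed
  then show "x \<in> coeffs_dvd (u j * upow \<beta>) \<longleftrightarrow> x \<in> coeffs_dvd (u j * upow \<gamma>)"
    if "x \<in> coeffs_dvd (upow \<gamma>)" for x
    using that unfolding coeffs_dvd_iff by (metis dvdE)
  show "\<exists>x\<in>coeffs_dvd (upow \<gamma>). x - y \<in> coeffs_dvd (u j * upow \<beta>)"
    if y: "y \<in> coeffs_dvd (upow \<beta>)" for y
  proof
    show "smult (R * b) y \<in> coeffs_dvd (upow \<gamma>)"
      using y by (auto simp: coeffs_dvd_iff R mult.assoc intro!: mult_dvd_mono)
    have *: "coeff (smult (R * b) y - y) c = (R * b - 1) * coeff y c" for c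
      by (simp add: algebra_simps)
    show "smult (R * b) y - y \<in> coeffs_dvd (u j * upow \<beta>)"
      unfolding coeffs_dvd_iff * using mult_dvd_mono[OF b] y by (simp add: coeffs_dvd_iff)
  qed
qed

text \<open>Neither exponent vector need dominate the other, so both are compared with their
  pointwise maximum.\<close>

lemma iso_upow:
  assumes j: "j < k" and eq: "\<beta> j = \<gamma> j"
  shows "iso_sq T (coeffs_dvd (upow \<beta>)) (coeffs_dvd (u j * upow \<beta>))
      (coeffs_dvd (upow \<gamma>)) (coeffs_dvd (u j * upow \<gamma>))"
proof -
  let ?m = "\<lambda>l. max (\<beta> l) (\<gamma> l)"
  note inv = invariant_upow upow_Suc'(2)[OF j]
  have "iso_sq T (coeffs_dvd (upow ?m)) (coeffs_dvd (u j * upow ?m))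
      (coeffs_dvd (upow \<beta>)) (coeffs_dvd (u j * upow \<beta>))"
    by (rule iso_upow_le) (use j eq in auto)
  then have "iso_sq T (coeffs_dvd (upow \<beta>)) (coeffs_dvd (u j * upow \<beta>))
      (coeffs_dvd (upow ?m)) (coeffs_dvd (u j * upow ?m))"
    by (rule iso_sq_sym) (rule inv)+
  moreover have "iso_sq T (coeffs_dvd (upow ?m)) (coeffs_dvd (u j * upow ?m))
      (coeffs_dvd (upow \<gamma>)) (coeffs_dvd (u j * upow \<gamma>))"
    by (rule iso_upow_le) (use j eq in auto)
  ultimately show ?thesis
    by (rule iso_sq_trans) (rule inv lsubspace_coeffs_dvd)+
qed

text \<open>Modulo \<open>u j * upow \<beta>\<close> the kernel of \<open>T 1 0\<close> is the part
  in degree 0, because \<open>T 1 0\<close> has nonzero weight in every positive degree. On degree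
  0, \<open>T g 1\<close> is multiplication by \<open>wt \<beta> j 1 0 * g * kap j\<close>.\<close>

lemma lowest_weight_iff:
  assumes j: "j < k"
  shows "(\<forall>x\<in>coeffs_dvd (upow \<beta>). T 1 0 x \<in> coeffs_dvd (u j * upow \<beta>) \<longrightarrow>
      T g 1 x - smult [:c:] x \<in> coeffs_dvd (u j * upow \<beta>))
    \<longleftrightarrow> u j dvd of_int (wt \<beta> j 1 0) * (g * kap j) - [:c:]" (is "?lhs \<longleftrightarrow> ?rhs")
proof -
  let ?d = "upow \<beta>"
  have jt: "j < t" using j k_le by simp
  have act: "u j * ?d dvd act g 1 0 (?d * q) - [:c:] * (?d * q) \<longleftrightarrow>
      u j dvd q * (of_int (wt \<beta> j 1 0) * (g * kap j) - [:c:])" for q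
  proof -
    have "u j * ?d dvd act g 1 0 (?d * q) - [:c:] * (?d * q) \<longleftrightarrow>
      u j * ?d dvd (act g 1 0 (?d * q) - [:c:] * (?d * q))
        - (act g 1 0 (?d * q) - ?d * (of_int (wt \<beta> j 1 0) * (q * g * kap j)))"
      by (subst dvd_diff_left_iff[OF act_cong[OF j]]) (rule refl)
    also have "(act g 1 0 (?d * q) - [:c:] * (?d * q))
        - (act g 1 0 (?d * q) - ?d * (of_int (wt \<beta> j 1 0) * (q * g * kap j)))
        = ?d * (q * (of_int (wt \<beta> j 1 0) * (g * kap j) - [:c:]))"
      by (simp add: algebra_simps)
    finally show ?thesis by (simp only: dvd_upow_mult_iff)
  qed
  show ?thesis
  proof
    assume lhs: ?lhs
    have "T 1 0 (monom ?d 0) = 0"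
      by (simp add: Top_monom)
    then have "T g 1 (monom ?d 0) - smult [:c:] (monom ?d 0) \<in> coeffs_dvd (u j * ?d)"
      using bspec[OF lhs, of "monom ?d 0"] monom_in_coeffs_dvd[of ?d ?d 0]
        lsubspaceD(1)[OF lsubspace_coeffs_dvd[of "u j * ?d"]] by simp
    then have "u j * ?d dvd coeff (T g 1 (monom ?d 0) - smult [:c:] (monom ?d 0)) 0"
      by (simp only: coeffs_dvd_iff)
    then show ?rhs
      using act[of 1] by (simp add: Top_monom)
  next
    assume rhs: ?rhs
    show ?lhs
    proof (intro ballI impI)
      fix x assume x: "x \<in> coeffs_dvd ?d" and low: "T 1 0 x \<in> coeffs_dvd (u j * ?d)"
      have "u j * ?d dvd act g 1 s (coeff x s) - [:c:] * coeff x s" for s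
      proof (cases s)
        case 0
        obtain q where "coeff x s = ?d * q" using x by (auto simp: coeffs_dvd_iff elim: dvdE)
        then show ?thesis using act[of q] rhs 0 by simp
      next
        case (Suc r)
        have "u j * ?d dvd act 1 0 s (coeff x s)"
          using low Suc by (auto simp: coeffs_dvd_iff coeff_Top dest: spec[of _ r])
        then have *: "u j * ?d dvd coeff x s"
          using act_dvd_iff[OF j, of \<beta> "coeff x s" 1 0 s] x wt_0_Suc[OF j] u_not_dvd_1[OF jt] Suc
          by (auto simp: coeffs_dvd_iff)
        then have "u j * ?d dvd act g 1 s (coeff x s)"
          using upow_dvd_act[of "\<beta>(j := Suc (\<beta> j))"] upow_Suc'(1)[OF j] by simp
        with * show ?thesis by (intro dvd_diff dvd_mult)
      qed
      then show "T g 1 x - smult [:c:] x \<in> coeffs_dvd (u j * ?d)"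
        by (simp add: coeffs_dvd_iff coeff_Top)
    qed
  qed
qed

text \<open>Two instances of the eigenvalue test suffice. With \<open>g = u j\<close> and c = 0 the
  condition holds on the left, and on the right it forces \<open>u j'\<close> to divide
  \<open>u j\<close>. With \<open>g\<close> an inverse of \<open>kap j\<close> modulo
  \<open>u j\<close> the scalar is \<open>\<beta> j - \<alpha> j\<close>, which recovers the
  exponent.\<close>

lemma iso_upow_imp_eq:
  assumes j: "j < k" "j' < k" and \<gamma>: "\<gamma> j' < \<alpha> j'"
    and iso: "iso_sq T (coeffs_dvd (upow \<beta>)) (coeffs_dvd (u j * upow \<beta>))
      (coeffs_dvd (upow \<gamma>)) (coeffs_dvd (u j' * upow \<gamma>))"
  shows "j = j' \<and> \<beta> j = \<gamma> j'"
proof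
  have jt: "j < t" "j' < t" using j k_le by auto
  have transfer: "u j' dvd of_int (wt \<gamma> j' 1 0) * (g * kap j') - [:c:]"
    if "u j dvd of_int (wt \<beta> j 1 0) * (g * kap j) - [:c:]" for g c
    using iso_sq_transfer_eigen[OF iso invariant_upow invariant_upow upow_Suc'(2)[OF j(2)]]
      that lowest_weight_iff[OF j(1)] lowest_weight_iff[OF j(2)] by blast
  have unit: "\<not> u j' dvd of_int z" if "z \<noteq> 0" for z
    using is_unit_of_int_poly[OF that] u_prime_elem[OF jt(2)]
    by (auto dest: dvd_unit_imp_unit prime_elem_not_unit)
  have "u j' dvd of_int (wt \<gamma> j' 1 0) * (u j * kap j')"
    using transfer[of "u j" 0] by simp
  then show jj: "j = j'"
    using unit[OF wt_Suc_0[of \<gamma> j' 0, OF \<gamma>]] u_not_dvd_kap[OF jt(2)] u_dvd_u_iff[OF jt(2,1)]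
    by (auto simp: u_dvd_mult_iff[OF jt(2)])
  obtain b where b: "u j dvd kap j * b - 1"
    using u_inverse[OF jt(1) u_not_dvd_kap[OF jt(1)]] .
  have wt: "of_int w * (b * kap j) - of_int z = of_int w * (kap j * b - 1) + of_int (w - z)" for w z :: int
    by (simp add: algebra_simps)
  have "u j dvd of_int (wt \<beta> j 1 0) * (b * kap j) - [:of_int (wt \<beta> j 1 0):]"
    using b wt[of "wt \<beta> j 1 0" "wt \<beta> j 1 0"] by (simp add: of_int_poly dvd_smult)
  then have "u j dvd of_int (wt \<gamma> j 1 0) * (b * kap j) - of_int (wt \<beta> j 1 0)"
    using transfer jj by (simp add: of_int_poly)
  then have "u j dvd of_int (wt \<gamma> j 1 0 - wt \<beta> j 1 0)"
    unfolding wt using b by (simp add: dvd_add_right_iff)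
  then have "wt \<gamma> j 1 0 = wt \<beta> j 1 0"
    using unit[of "wt \<gamma> j 1 0 - wt \<beta> j 1 0"] jj by auto
  then show "\<beta> j = \<gamma> j'"
    using jj by (simp add: wt_def)
qed

section \<open>The filtration and its factors\<close>

definition lev :: "nat \<Rightarrow> nat \<Rightarrow> nat" where
  "lev i = (\<lambda>l. min (\<alpha> l - 1) i)"

lemma lev_high: "i + 2 \<le> \<alpha> l \<Longrightarrow> lev i l = i" "i + 2 \<le> \<alpha> l \<Longrightarrow> lev (Suc i) l = Suc i"
  and lev_low: "\<not> i + 2 \<le> \<alpha> l \<Longrightarrow> lev (Suc i) l = lev i l"
  by (auto simp: lev_def)

text \<open>The exponents of \<open>Vbar\<close>: those of the lower end \<open>P (Suc i)\<close>,
  with \<open>j\<close> held back at \<open>i\<close>. For \<open>i + 2 \<le> \<alpha> j\<close> the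
  two subspaces thus differ by a single step at \<open>j\<close>.\<close>

definition vex :: "nat \<Rightarrow> nat \<Rightarrow> nat \<Rightarrow> nat" where
  "vex i j = (lev (Suc i))(j := i)"

abbreviation "P \<equiv> Pset u \<alpha> k"
abbreviation "V \<equiv> Vbar u \<alpha> k"
abbreviation "K \<equiv> Kset u \<alpha> t"
abbreviation "m \<equiv> mh \<alpha> k"

lemma Theta_eq: "Theta u \<alpha> k i = upow (lev i)"
  by (simp add: Theta_def upow_def lev_def)

lemma Pset_eq: "P i = coeffs_dvd (upow (lev i))"
  by (simp add: Pset_def coeffs_dvd_def Theta_eq)

lemma invariant_Pset: "invariant T (P i)"
  by (simp add: Pset_eq invariant_upow)

text \<open>From level \<open>i\<close> to \<open>i + 1\<close> only the primes with
  \<open>i + 2 \<le> \<alpha> l\<close> gain an exponent; the others have already reached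
  \<open>\<alpha> l - 1\<close>.\<close>

lemma upow_lev_Suc_dvd_iff:
  "upow (lev (Suc i)) dvd a \<longleftrightarrow> upow (lev i) dvd a \<and> (\<forall>l<k. i + 2 \<le> \<alpha> l \<longrightarrow> u l ^ Suc i dvd a)"
proof -
  have "u l ^ lev (Suc i) l dvd a \<longleftrightarrow> u l ^ lev i l dvd a \<and> (i + 2 \<le> \<alpha> l \<longrightarrow> u l ^ Suc i dvd a)" for l
    using power_le_dvd[of "u l" "Suc i" a i]
    by (cases "i + 2 \<le> \<alpha> l") (auto simp: lev_high lev_low simp del: power_Suc)
  then show ?thesis by (auto simp: upow_dvd_iff simp del: power_Suc)
qed

lemma upow_vex_dvd_iff:
  assumes "i + 2 \<le> \<alpha> j"
  shows "upow (vex i j) dvd a \<longleftrightarrow>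
    upow (lev i) dvd a \<and> (\<forall>l<k. l \<noteq> j \<and> i + 2 \<le> \<alpha> l \<longrightarrow> u l ^ Suc i dvd a)"
proof -
  have "u l ^ vex i j l dvd a \<longleftrightarrow> u l ^ lev i l dvd a \<and> (l \<noteq> j \<and> i + 2 \<le> \<alpha> l \<longrightarrow> u l ^ Suc i dvd a)" for l
    using power_le_dvd[of "u l" "Suc i" a i] assms
    by (cases "i + 2 \<le> \<alpha> l"; cases "l = j") (auto simp: vex_def lev_high lev_low simp del: power_Suc)
  then show ?thesis by (auto simp: upow_dvd_iff simp del: power_Suc)
qed

lemma Pset_Suc_eq:
  assumes "j < k" "i + 2 \<le> \<alpha> j"
  shows "P (Suc i) = coeffs_dvd (u j * upow (vex i j))"
proof -
  have "(vex i j)(j := Suc (vex i j j)) = lev (Suc i)"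
    using assms by (auto simp: vex_def lev_def fun_eq_iff)
  then show ?thesis
    using upow_Suc[OF assms(1), of "vex i j"] by (simp add: Pset_eq)
qed

lemma lev_power_dvd: "upow (lev i) dvd a \<Longrightarrow> l < k \<Longrightarrow> i + 2 \<le> \<alpha> l \<Longrightarrow> u l ^ i dvd a"
  using lev_high(1)[of i l] by (auto simp: upow_dvd_iff)

lemma lev_power_Suc_dvd_mult:
  assumes "l < k" "i + 2 \<le> \<alpha> l"
  shows "u l ^ Suc i dvd u l * upow (lev i)"
  using lev_power_dvd[OF dvd_refl assms] by (simp add: mult_dvd_mono)

lemma u_dvd_div_upow_lev_iff:
  assumes "l < k" "i + 2 \<le> \<alpha> l" and dvd: "upow (lev i) dvd a"
  shows "u l dvd a div upow (lev i) \<longleftrightarrow> u l ^ Suc i dvd a"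
proof -
  obtain q where q: "a = upow (lev i) * q" using dvd by (elim dvdE)
  have "u l dvd a div upow (lev i) \<longleftrightarrow> u l * upow (lev i) dvd a"
    using upow_nonzero by (simp add: q dvd_upow_mult_iff)
  also have "u l * upow (lev i) = upow ((lev i)(l := Suc i))"
    using upow_Suc[OF assms(1), of "lev i"] assms by (simp add: lev_high)
  also have "\<dots> dvd a \<longleftrightarrow> u l ^ Suc i dvd a"
    using dvd assms(1) by (auto simp: upow_dvd_iff simp del: power_Suc)
  finally show ?thesis .
qed

lemma Vbar_eq:
  assumes "i + 2 \<le> \<alpha> j"
  shows "V i j = coeffs_dvd (upow (vex i j))"
  unfolding Vbar_def Pset_eq coeffs_dvd_def Theta_eq upow_vex_dvd_iff[OF assms]
  by (auto simp: u_dvd_div_upow_lev_iff)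

lemma irred_Vbar:
  assumes "j < k" "i + 2 \<le> \<alpha> j"
  shows "irred_sq T (V i j) (P (Suc i))"
  unfolding Vbar_eq[OF assms(2)] Pset_Suc_eq[OF assms]
  using assms by (intro irred_upow) (auto simp: vex_def)

lemma iso_Vbar_iff:
  assumes "j < k" "i + 2 \<le> \<alpha> j" "j' < k" "i' + 2 \<le> \<alpha> j'"
  shows "iso_sq T (V i j) (P (Suc i)) (V i' j') (P (Suc i')) \<longleftrightarrow> i = i' \<and> j = j'"
proof
  assume "iso_sq T (V i j) (P (Suc i)) (V i' j') (P (Suc i'))"
  then have "j = j' \<and> vex i j j = vex i' j' j'"
    unfolding Vbar_eq[OF assms(2)] Pset_Suc_eq[OF assms(1,2)] Vbar_eq[OF assms(4)] Pset_Suc_eq[OF assms(3,4)]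
    by (rule iso_upow_imp_eq[rotated 3]) (use assms in \<open>auto simp: vex_def\<close>)
  then show "i = i' \<and> j = j'" by (auto simp: vex_def)
next
  assume "i = i' \<and> j = j'"
  then show "iso_sq T (V i j) (P (Suc i)) (V i' j') (P (Suc i'))"
    using iso_sq_refl invariantD(1)[OF invariant_Pset] by blast
qed

lemma iso_upow_Vbar:
  assumes "j < k" "\<beta> j + 2 \<le> \<alpha> j"
  shows "iso_sq T (coeffs_dvd (upow \<beta>)) (coeffs_dvd (u j * upow \<beta>)) (V (\<beta> j) j) (P (Suc (\<beta> j)))"
  unfolding Vbar_eq[OF assms(2)] Pset_Suc_eq[OF assms] by (rule iso_upow) (auto simp: vex_def assms)

section \<open>The gcd of h and h', and the two ends of the filtration\<close>

lemma hP_eq: "hP u \<alpha> t = upow (\<lambda>l. \<alpha> l - 1) * pih"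
  and pderiv_hP_eq: "pderiv (hP u \<alpha> t) = upow (\<lambda>l. \<alpha> l - 1) * ch"
proof -
  have "u l ^ \<alpha> l = u l ^ (\<alpha> l - 1) * u l" if "l < t" for l
    using \<alpha>_big \<alpha>_one that by (cases "l < k"; cases "\<alpha> l") (auto simp: not_less)
  then have "hP u \<alpha> t = (\<Prod>l<t. u l ^ (\<alpha> l - 1)) * pih"
    by (simp add: hP_def piH_def flip: prod.distrib)
  moreover have "(\<Prod>l<t. u l ^ (\<alpha> l - 1)) = upow (\<lambda>l. \<alpha> l - 1)"
    unfolding upow_def using k_le \<alpha>_one by (intro prod.mono_neutral_right) auto
  ultimately show hP: "hP u \<alpha> t = upow (\<lambda>l. \<alpha> l - 1) * pih" by simp
  have "pih \<noteq> 0" using hP_nonzero hP by auto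
  moreover have "pih * pderiv (hP u \<alpha> t) = pih * (upow (\<lambda>l. \<alpha> l - 1) * ch)"
    using pih_pderiv_hP hP by (simp add: ch_eq mult_ac)
  ultimately show "pderiv (hP u \<alpha> t) = upow (\<lambda>l. \<alpha> l - 1) * ch" by simp
qed

lemma u_not_dvd_ch:
  assumes "j < t"
  shows "\<not> u j dvd ch"
proof -
  have "\<alpha> j \<noteq> 0" using \<alpha>_big \<alpha>_one assms by (cases "j < k") auto
  then have "\<not> u j dvd of_int (int (\<alpha> j))"
    using is_unit_of_int_poly[of "int (\<alpha> j)"] u_prime_elem[OF assms]
    by (auto dest: dvd_unit_imp_unit prime_elem_not_unit simp del: of_int_of_nat_eq)
  then show ?thesis
    using dvd_cong_iff[OF ch_cong[OF assms]] u_not_dvd_kap[OF assms] by (simp add: u_dvd_mult_iff assms)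
qed

text \<open>h and h' are the same \<open>upow\<close> times \<open>pih\<close> and \<open>ch\<close>
  respectively, and these are coprime because \<open>ch\<close> is \<open>\<alpha> j * kap j\<close>
  modulo each \<open>u j\<close>.\<close>

lemma gcd_hP: "gcd (hP u \<alpha> t) (pderiv (hP u \<alpha> t)) = normalize (upow (\<lambda>l. \<alpha> l - 1))"
proof -
  have "coprime pih ch"
    unfolding piH_def
    by (intro prod_coprime_left) (auto intro!: prime_elem_imp_coprime u_prime_elem u_not_dvd_ch)
  then show ?thesis
    unfolding pderiv_hP_eq unfolding hP_eq by (simp add: gcd_mult_left)
qed

lemma Kset_eq: "K = coeffs_dvd (upow (\<lambda>l. \<alpha> l - 1))"
  by (simp add: Kset_def coeffs_dvd_def gcd_hP)

lemma size_prime_factorization_gcd: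
  "size (prime_factorization (gcd (hP u \<alpha> t) (pderiv (hP u \<alpha> t)))) = (\<Sum>j<k. \<alpha> j - 1)"
proof -
  have "prime_factorization (upow (\<lambda>l. \<alpha> l - 1)) = (\<Sum>l<k. prime_factorization (u l ^ (\<alpha> l - 1)))"
    unfolding upow_def using u_nonzero k_le by (intro prime_factorization_prod) auto
  also have "\<dots> = (\<Sum>l<k. replicate_mset (\<alpha> l - 1) (u l))"
    using u_prime k_le by (intro sum.cong prime_factorization_prime_power) auto
  finally show ?thesis
    by (simp add: gcd_hP)
qed

lemma less_mh_iff: "i < m \<longleftrightarrow> (\<exists>j<k. i + 2 \<le> \<alpha> j)"
proof -
  have "(\<lambda>j. \<alpha> j - 1) ` {..<k} \<noteq> {}" using k_pos by (auto simp: lessThan_empty_iff)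
  then have "i < m \<longleftrightarrow> (\<exists>j<k. i < \<alpha> j - 1)" by (auto simp: mh_def Max_gr_iff)
  moreover have "i < \<alpha> j - 1 \<longleftrightarrow> i + 2 \<le> \<alpha> j" for j by linarith
  ultimately show ?thesis by simp
qed

lemma Pset_mh: "P m = K"
proof -
  have "lev m l = \<alpha> l - 1" if "l < k" for l
    using less_mh_iff[of m] that by (auto simp: lev_def min_def)
  then have "upow (lev m) = upow (\<lambda>l. \<alpha> l - 1)"
    unfolding upow_def by (intro prod.cong) auto
  then show ?thesis by (simp add: Pset_eq Kset_eq)
qed

lemma Pset_0: "P 0 = UNIV"
  by (auto simp: Pset_eq coeffs_dvd_def lev_def upow_def)

lemma Kset_subset: "K \<subseteq> P i"
  unfolding Pset_eq Kset_eq
  by (rule coeffs_dvd_mono) (auto simp: upow_def lev_def intro!: prod_dvd_prod le_imp_power_dvd)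

lemma Pset_Suc_psubset:
  assumes "i < m"
  shows "P (Suc i) \<subset> P i"
proof -
  obtain j where j: "j < k" "i + 2 \<le> \<alpha> j" using assms less_mh_iff by blast
  then have "P (Suc i) \<subset> V i j" using irred_Vbar by (auto simp: irred_sq_def)
  moreover have "V i j \<subseteq> P i" by (auto simp: Vbar_def)
  ultimately show ?thesis by blast
qed

theorem filtration:
  "P 0 = UNIV \<and> P m = K \<and> (\<forall>i\<le>m. invariant T (P i) \<and> K \<subseteq> P i) \<and> (\<forall>i<m. P (Suc i) \<subset> P i)"
  using Pset_0 Pset_mh invariant_Pset Kset_subset Pset_Suc_psubset by blast

section \<open>Decomposition of the factors and the action on them\<close>

lemma u_dvd_mult_upow_lev:
  assumes "l < k" "i + 2 \<le> \<alpha> l" "u l dvd b" "upow (lev i) dvd a"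
  shows "u l ^ Suc i dvd b * a"
  using mult_dvd_mono[OF assms(3) lev_power_dvd[OF assms(4,1,2)]] by simp

text \<open>The Chinese remainder idempotents give the components \<open>e j * x\<close>. Even when
  summed over \<open>?J\<close> only, they add up to 1 modulo \<open>u l\<close> for
  \<open>l\<close> in \<open>?J\<close>, and passing from level \<open>i\<close> to
  \<open>i + 1\<close> tests no other primes.\<close>

lemma direct_sum_Vbar:
  assumes e: "\<And>j l. j < k \<Longrightarrow> l < k \<Longrightarrow> u l dvd e j - (if l = j then 1 else 0)"
  shows "direct_sum_sq T (P i) (P (Suc i)) {j. j < k \<and> i + 2 \<le> \<alpha> j} (V i)"
  unfolding direct_sum_sq_def
proof (intro conjI ballI allI impI)
  let ?J = "{j. j < k \<and> i + 2 \<le> \<alpha> j}"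
  show "finite ?J" by simp
  show "invariant T (V i j)" "P (Suc i) \<subseteq> V i j" "V i j \<subseteq> P i" if "j \<in> ?J" for j
    using irred_Vbar[of j i] that by (auto simp: irred_sq_def Vbar_def)
  show "\<exists>f. (\<forall>j\<in>?J. f j \<in> V i j) \<and> x - (\<Sum>j\<in>?J. f j) \<in> P (Suc i)" if "x \<in> P i" for x
  proof (intro exI[of _ "\<lambda>j. smult (e j) x"] conjI ballI)
    have x: "upow (lev i) dvd coeff x c" for c
      using that by (simp add: Pset_eq coeffs_dvd_iff)
    show "smult (e j) x \<in> V i j" if j: "j \<in> ?J" for j
    proof -
      have "u l dvd e j" if "l < k" "l \<noteq> j" for l
        using e[of j l] that j by simp
      then show ?thesis
        using j x by (auto simp: Vbar_eq coeffs_dvd_iff upow_vex_dvd_iff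
            intro!: u_dvd_mult_upow_lev simp del: power_Suc)
    qed
    have "u l dvd 1 - (\<Sum>j\<in>?J. e j)" if l: "l \<in> ?J" for l
    proof -
      have "1 - (\<Sum>j\<in>?J. e j) = - (\<Sum>j\<in>?J. e j - (if l = j then 1 else 0))"
        using l by (simp add: sum_subtractf)
      also have "u l dvd \<dots>"
        using l e by (intro dvd_minus_iff[THEN iffD2] dvd_sum) auto
      finally show ?thesis .
    qed
    then have "upow (lev (Suc i)) dvd (1 - (\<Sum>j\<in>?J. e j)) * coeff x c" for c
      unfolding upow_lev_Suc_dvd_iff using x by (auto intro!: u_dvd_mult_upow_lev simp del: power_Suc)
    moreover have "coeff (x - (\<Sum>j\<in>?J. smult (e j) x)) c = (1 - (\<Sum>j\<in>?J. e j)) * coeff x c" for c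
      by (simp add: coeff_sum left_diff_distrib sum_distrib_right)
    ultimately show "x - (\<Sum>j\<in>?J. smult (e j) x) \<in> P (Suc i)"
      unfolding Pset_eq coeffs_dvd_iff by simp
  qed
  show "f j \<in> P (Suc i)" if f: "(\<forall>j\<in>?J. f j \<in> V i j) \<and> (\<Sum>j\<in>?J. f j) \<in> P (Suc i)" and j: "j \<in> ?J" for f j
  proof -
    have V: "upow (lev i) dvd coeff (f l) c" "l' < k \<Longrightarrow> l' \<noteq> l \<Longrightarrow> i + 2 \<le> \<alpha> l' \<Longrightarrow> u l' ^ Suc i dvd coeff (f l) c"
      if "l \<in> ?J" for l l' c
    proof -
      have "upow (vex i l) dvd coeff (f l) c"
        using f that Vbar_eq[of i l] by (auto simp: coeffs_dvd_iff)
      then show "upow (lev i) dvd coeff (f l) c"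
        "l' < k \<Longrightarrow> l' \<noteq> l \<Longrightarrow> i + 2 \<le> \<alpha> l' \<Longrightarrow> u l' ^ Suc i dvd coeff (f l) c"
        using that by (auto simp: upow_vex_dvd_iff simp del: power_Suc)
    qed
    \<comment> \<open>Independence is tested at \<open>u j\<close>: the total and all other summands
      are divisible by \<open>u j ^ Suc i\<close>, hence so is \<open>f j\<close>.\<close>
    have "u j ^ Suc i dvd coeff (f j) c" for c
    proof -
      have "u j ^ Suc i dvd (\<Sum>l\<in>?J. coeff (f l) c)"
        using f j by (auto simp: Pset_eq coeffs_dvd_iff coeff_sum upow_lev_Suc_dvd_iff simp del: power_Suc)
      moreover have "(\<Sum>l\<in>?J. coeff (f l) c) = coeff (f j) c + (\<Sum>l\<in>?J - {j}. coeff (f l) c)"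
        using j by (intro sum.remove) auto
      moreover have "u j ^ Suc i dvd (\<Sum>l\<in>?J - {j}. coeff (f l) c)"
        using V(2)[of _ j] j by (intro dvd_sum) auto
      ultimately show ?thesis
        by (simp add: dvd_add_left_iff del: power_Suc)
    qed
    then show ?thesis
      using V[OF j] unfolding Pset_eq coeffs_dvd_iff upow_lev_Suc_dvd_iff by metis
  qed
qed

lemma semisimple_factor:
  assumes "\<And>j l. j < k \<Longrightarrow> l < k \<Longrightarrow> u l dvd e j - (if l = j then 1 else 0)" and "i < m"
  shows "semisimple_sq T (P i) (P (Suc i))"
  by (rule direct_sum_imp_semisimple[OF direct_sum_Vbar[OF assms(1)]])
    (use irred_Vbar invariant_Pset Pset_Suc_psubset[OF assms(2)] in auto)

text \<open>Modulo \<open>u j\<close> the operator multiplies by a multiple of \<open>g\<close>,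
  which is zero there; the derivative of \<open>g\<close> inside \<open>delta0\<close> is harmless,
  as it carries the factor \<open>pih\<close>.\<close>

lemma nilpotent_action:
  assumes g: "rad u k dvd g" and p: "p \<in> P i"
  shows "T g n p \<in> P (Suc i)"
proof -
  have "upow (lev (Suc i)) dvd act g n l a" if a: "upow (lev i) dvd a" for l a
    unfolding upow_lev_Suc_dvd_iff
  proof (intro conjI allI impI)
    show "upow (lev i) dvd act g n l a" by (rule upow_dvd_act[OF a])
    fix j assume j: "j < k" "i + 2 \<le> \<alpha> j"
    have "u j dvd rad u k"
      unfolding rad_def using j by auto
    then have "u j * upow (lev i) dvd act g n l a"
      using act_dvd_iff[OF j(1) a] g dvd_trans by blast
    then show "u j ^ Suc i dvd act g n l a"
      using lev_power_Suc_dvd_mult[OF j] dvd_trans by blast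
  qed
  then show ?thesis
    using p by (auto simp: Pset_eq coeffs_dvd_iff coeff_Top)
qed

text \<open>Modulo \<open>u j\<close>, \<open>delta0 1\<close> is
  \<open>- (\<alpha> j - 1) * kap j\<close>, and \<open>\<nu>\<close> inverts it. Together with the
  sign in front of \<open>T\<close> this turns weight times \<open>kap j\<close> into
  \<open>l - n * \<mu>\<close>; here \<open>n\<close> is the Witt index plus one.\<close>

lemma witt_action:
  assumes e: "\<And>j l. j < k \<Longrightarrow> l < k \<Longrightarrow> u l dvd e j - (if l = j then 1 else 0)"
    and \<nu>: "rad u k dvd \<nu> * delta0 u \<alpha> t 1 - 1"
    and j: "j < k" "i + 2 \<le> \<alpha> j" and q: "q < k"
  shows "- T (g * e q * \<nu>) n (monom (Theta u \<alpha> k i * f * e j) l)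
      - (if q = j then monom (smult (of_nat l - of_nat n * (of_nat (\<alpha> j - i) / of_nat (\<alpha> j - 1)))
                              (Theta u \<alpha> k i * f * g * e j)) (n + l - 1) else 0)
      \<in> P (Suc i)"
proof -
  let ?d = "upow (lev i)" and ?g = "g * e q * \<nu>"
  define r where "r = (of_nat l - of_nat n * (of_nat (\<alpha> j - i) / of_nat (\<alpha> j - 1)) :: 'a)"
  define R where "R = (if q = j then smult r (f * g * e j) else 0)"
  define A where "A = - act ?g n l (?d * (f * e j)) - ?d * R"
  have "upow (lev (Suc i)) dvd A"
    unfolding upow_lev_Suc_dvd_iff
  proof (intro conjI allI impI)
    show "?d dvd A"
      unfolding A_def by (intro dvd_diff dvd_minus_iff[THEN iffD2] upow_dvd_act) auto
    fix s assume s: "s < k" "i + 2 \<le> \<alpha> s"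
    have st: "s < t" using s k_le by simp
    define w where "w = wt (lev i) s n l"
    have "u s dvd of_int w * ((f * e j) * ?g * kap s) + R"
    proof (cases "s = j")
      case False
      then have "u s dvd e j" using e[OF j(1) s(1)] by simp
      then show ?thesis by (auto simp: R_def dvd_smult)
    next
      case sj: True
      show ?thesis
      proof (cases "q = j")
        case False
        then have "u s dvd e q" using e[OF q s(1)] sj by simp
        with False show ?thesis by (simp add: R_def)
      next
        case True
        have "of_nat (\<alpha> j - 1) \<noteq> (0 :: 'a)"
          using j by simp
        then have "r * of_nat (\<alpha> j - 1) = of_nat l * of_nat (\<alpha> j - 1) - of_nat n * of_nat (\<alpha> j - i)"
          by (simp add: r_def left_diff_distrib)
        moreover have "of_nat (\<alpha> j - 1) = (of_nat (\<alpha> j) - 1 :: 'a)" "of_nat (\<alpha> j - i) = (of_nat (\<alpha> j) - of_nat i :: 'a)"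
          using j by (auto simp: of_nat_diff)
        moreover have "lev i s = i" using lev_high s by simp
        ultimately have w: "of_int w = r * of_nat (\<alpha> j - 1)"
          by (simp add: w_def wt_def sj)
        have "u s dvd rad u k" unfolding rad_def using s by auto
        then have d\<nu>: "u s dvd \<nu> * delta0 u \<alpha> t 1 - 1" using \<nu> dvd_trans by blast
        have de: "u s dvd e j - 1" using e[OF j(1) s(1)] sj by simp
        \<comment> \<open>The congruences for \<open>\<nu>\<close>, \<open>delta0 1\<close> and
          \<open>e j\<close> are combined so that
          \<open>(\<alpha> s - 1) * e j * \<nu> * kap s\<close> becomes -1 modulo
          \<open>u s\<close>.\<close>
        have "u s dvd - (\<nu> * delta0 u \<alpha> t 1 - 1)
            + \<nu> * ((pderiv pih - kap s) - (ch - of_nat (\<alpha> s) * kap s))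
            + (of_nat (\<alpha> s) - 1) * \<nu> * kap s * (e j - 1)"
          by (intro dvd_add dvd_minus_iff[THEN iffD2, OF d\<nu>] dvd_mult[OF de]
              dvd_mult[OF dvd_diff[OF pderiv_pih_cong[OF st] ch_cong[OF st]]])
        also have "\<dots> = (of_nat (\<alpha> s) - 1) * e j * \<nu> * kap s + 1"
          by (simp add: delta0_eq algebra_simps)
        finally have "u s dvd smult r (f * g * e j) * ((of_nat (\<alpha> s) - 1) * e j * \<nu> * kap s + 1)"
          by (rule dvd_mult)
        also have "\<dots> = of_int w * ((f * e j) * ?g * kap s) + R"
        proof -
          define c where "c = [:r:]"
          have rc: "smult r x = c * x" for x by (simp add: c_def)
          have "(of_int w :: 'a poly) = smult r (of_nat (\<alpha> s) - 1)"
            using w j sj by (simp add: of_int_poly of_nat_poly of_nat_diff one_pCons)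
          then have wc: "(of_int w :: 'a poly) = c * (of_nat (\<alpha> s) - 1)"
            by (simp only: rc)
          show ?thesis
            unfolding wc R_def using True by (simp add: rc algebra_simps)
        qed
        finally show ?thesis .
      qed
    qed
    then have "u s * ?d dvd ?d * (of_int w * ((f * e j) * ?g * kap s) + R)"
      by (simp add: dvd_upow_mult_iff)
    then have "u s * ?d dvd - (act ?g n l (?d * (f * e j)) - ?d * (of_int w * ((f * e j) * ?g * kap s)))
        - ?d * (of_int w * ((f * e j) * ?g * kap s) + R)"
      unfolding w_def by (intro dvd_diff dvd_minus_iff[THEN iffD2] act_cong s)
    also have "\<dots> = A"
      by (simp add: A_def algebra_simps)
    finally show "u s ^ Suc i dvd A"
      using lev_power_Suc_dvd_mult[OF s] dvd_trans by blast
  qed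
  then have "monom A (n + l - 1) \<in> P (Suc i)"
    by (simp only: Pset_eq monom_in_coeffs_dvd)
  also have "monom A (n + l - 1) = - T ?g n (monom (Theta u \<alpha> k i * f * e j) l)
      - (if q = j then monom (smult r (Theta u \<alpha> k i * f * g * e j)) (n + l - 1) else 0)"
    by (simp add: A_def R_def Theta_eq Top_monom mult.assoc flip: diff_monom minus_monom)
  finally show ?thesis unfolding r_def .
qed

section \<open>Composition series\<close>

text \<open>Induction on the number of exponent steps left. Any \<open>j\<close> below its bound may
  be raised; the series of the smaller subspace is then extended at its upper end by a step labelled
  with \<open>j\<close> and its old exponent. So each prime contributes every exponent from
  \<open>\<beta> j\<close> to \<open>\<alpha> j - 2\<close> exactly once.\<close>

lemma labelled_comp_series:
  assumes "\<And>j. j < k \<Longrightarrow> \<beta> j \<le> \<alpha> j - 1" and "N = (\<Sum>j<k. \<alpha> j - 1 - \<beta> j)"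
  shows "\<exists>M \<rho>. comp_series T (coeffs_dvd (upow \<beta>)) K M N \<and>
    bij_betw \<rho> {..<N} {(i, j). j < k \<and> \<beta> j \<le> i \<and> i + 2 \<le> \<alpha> j} \<and>
    (\<forall>l<N. iso_sq T (M (Suc l)) (M l) (V (fst (\<rho> l)) (snd (\<rho> l))) (P (Suc (fst (\<rho> l)))))"
  using assms
proof (induction N arbitrary: \<beta>)
  case 0
  then have \<beta>: "\<beta> j = \<alpha> j - 1" if "j < k" for j
    using that 0 by (intro antisym) (auto simp: le_diff_conv)
  then have "upow \<beta> = upow (\<lambda>l. \<alpha> l - 1)"
    unfolding upow_def by (intro prod.cong) auto
  then have "coeffs_dvd (upow \<beta>) = K"
    by (simp add: Kset_eq)
  moreover have "{(i, j). j < k \<and> \<beta> j \<le> i \<and> i + 2 \<le> \<alpha> j} = {}"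
    using \<beta> by force
  ultimately show ?case
    by (intro exI[of _ "\<lambda>_. K"]) (auto simp: comp_series_def bij_betw_def)
next
  case (Suc N)
  have "\<exists>j<k. \<alpha> j - 1 - \<beta> j \<noteq> 0"
  proof (rule ccontr)
    assume "\<not> (\<exists>j<k. \<alpha> j - 1 - \<beta> j \<noteq> 0)"
    then have "(\<Sum>j<k. \<alpha> j - 1 - \<beta> j) = 0" by (intro sum.neutral) auto
    then show False using Suc.prems(2) by simp
  qed
  then obtain j where j: "j < k" "\<alpha> j - 1 - \<beta> j \<noteq> 0" by blast
  define \<beta>' where "\<beta>' = \<beta>(j := Suc (\<beta> j))"
  have "(\<Sum>l<k. \<alpha> l - 1 - \<gamma> l) = (\<alpha> j - 1 - \<gamma> j) + (\<Sum>l\<in>{..<k} - {j}. \<alpha> l - 1 - \<gamma> l)" for \<gamma>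
    using j by (intro sum.remove) auto
  note split = this[of \<beta>] this[of \<beta>']
  have "(\<Sum>l\<in>{..<k} - {j}. \<alpha> l - 1 - \<beta>' l) = (\<Sum>l\<in>{..<k} - {j}. \<alpha> l - 1 - \<beta> l)"
    by (simp add: \<beta>'_def)
  then have N: "N = (\<Sum>l<k. \<alpha> l - 1 - \<beta>' l)"
    using split Suc.prems(2) j by (simp add: \<beta>'_def)
  have "\<beta>' l \<le> \<alpha> l - 1" if "l < k" for l
    using Suc.prems(1)[OF that] j by (auto simp: \<beta>'_def)
  from Suc.IH[OF this N] obtain M \<rho> where M: "comp_series T (coeffs_dvd (upow \<beta>')) K M N"
    and \<rho>: "bij_betw \<rho> {..<N} {(i, j). j < k \<and> \<beta>' j \<le> i \<and> i + 2 \<le> \<alpha> j}"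
    and iso: "\<forall>l<N. iso_sq T (M (Suc l)) (M l) (V (fst (\<rho> l)) (snd (\<rho> l))) (P (Suc (fst (\<rho> l))))"
    by blast
  define M' where "M' = M(Suc N := coeffs_dvd (upow \<beta>))"
  define \<rho>' where "\<rho>' = \<rho>(N := (\<beta> j, j))"
  have top: "M N = coeffs_dvd (u j * upow \<beta>)"
    using M upow_Suc[OF j(1), of \<beta>] by (simp add: comp_series_def \<beta>'_def)
  have "irred_sq T (M' (Suc l)) (M' l)" if "l < Suc N" for l
    using M that irred_upow[of j \<beta>] j top
    by (cases "l = N") (auto simp: M'_def comp_series_def)
  then have "comp_series T (coeffs_dvd (upow \<beta>)) K M' (Suc N)"
    using M by (auto simp: comp_series_def M'_def)
  moreover have "bij_betw \<rho>' {..<Suc N} {(i, j). j < k \<and> \<beta> j \<le> i \<and> i + 2 \<le> \<alpha> j}"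
  proof -
    have "bij_betw \<rho>' {..<N} {(i, j). j < k \<and> \<beta>' j \<le> i \<and> i + 2 \<le> \<alpha> j}"
      using \<rho> by (rule bij_betw_cong[THEN iffD1, rotated]) (auto simp: \<rho>'_def)
    then have "bij_betw \<rho>' ({..<N} \<union> {N}) ({(i, j). j < k \<and> \<beta>' j \<le> i \<and> i + 2 \<le> \<alpha> j} \<union> {\<rho>' N})"
      by (intro notIn_Un_bij_betw) (auto simp: \<rho>'_def \<beta>'_def)
    moreover have "{..<N} \<union> {N} = {..<Suc N}" by auto
    moreover have "{(i, j). j < k \<and> \<beta>' j \<le> i \<and> i + 2 \<le> \<alpha> j} \<union> {\<rho>' N}
        = {(i, j). j < k \<and> \<beta> j \<le> i \<and> i + 2 \<le> \<alpha> j}"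
      using j by (auto simp: \<rho>'_def \<beta>'_def split: if_splits)
    ultimately show ?thesis by simp
  qed
  moreover have "iso_sq T (M' (Suc l)) (M' l) (V (fst (\<rho>' l)) (snd (\<rho>' l))) (P (Suc (fst (\<rho>' l))))"
    if "l < Suc N" for l
    using iso that iso_upow_Vbar[of j \<beta>] j top
    by (cases "l = N") (auto simp: M'_def \<rho>'_def)
  ultimately show ?case by blast
qed

theorem composition_series:
  "(\<exists>M. comp_series T UNIV K M (\<Sum>j<k. \<alpha> j - 1)) \<and>
   (\<forall>M n. comp_series T UNIV K M n \<longrightarrow> n = (\<Sum>j<k. \<alpha> j - 1) \<and>
     (\<exists>\<sigma>. bij_betw \<sigma> {..<n} {(i, j). i < m \<and> j < k \<and> i + 2 \<le> \<alpha> j} \<and>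
        (\<forall>l<n. iso_sq T (M (Suc l)) (M l) (V (fst (\<sigma> l)) (snd (\<sigma> l))) (P (Suc (fst (\<sigma> l)))))))"
proof -
  let ?N = "\<Sum>j<k. \<alpha> j - 1" and ?S = "{(i, j). i < m \<and> j < k \<and> i + 2 \<le> \<alpha> j}"
  have "coeffs_dvd (upow (\<lambda>_. 0)) = UNIV"
    by (auto simp: coeffs_dvd_def upow_def)
  moreover have "{(i, j). j < k \<and> (0::nat) \<le> i \<and> i + 2 \<le> \<alpha> j} = ?S"
    using less_mh_iff by auto
  ultimately obtain M0 \<rho> where M0: "comp_series T UNIV K M0 ?N" and \<rho>: "bij_betw \<rho> {..<?N} ?S"
    and iso0: "\<And>l. l < ?N \<Longrightarrow> iso_sq T (M0 (Suc l)) (M0 l) (V (fst (\<rho> l)) (snd (\<rho> l))) (P (Suc (fst (\<rho> l))))"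
    using labelled_comp_series[of "\<lambda>_. 0" ?N] by auto
  have U: "invariant T UNIV"
    using invariant_Pset[of 0] by (simp add: Pset_0)
  have "n = ?N \<and> (\<exists>\<sigma>. bij_betw \<sigma> {..<n} ?S \<and>
      (\<forall>l<n. iso_sq T (M (Suc l)) (M l) (V (fst (\<sigma> l)) (snd (\<sigma> l))) (P (Suc (fst (\<sigma> l))))))"
    if M: "comp_series T UNIV K M n" for M n
  proof -
    obtain \<tau> where n: "n = ?N" and \<tau>: "bij_betw \<tau> {..<n} {..<?N}"
      and iso: "\<And>l. l < n \<Longrightarrow> iso_sq T (M (Suc l)) (M l) (M0 (Suc (\<tau> l))) (M0 (\<tau> l))"
      using jordan_hoelder[OF M M0 U] by metis
    have "iso_sq T (M (Suc l)) (M l) (V (fst (\<rho> (\<tau> l))) (snd (\<rho> (\<tau> l)))) (P (Suc (fst (\<rho> (\<tau> l)))))"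
      if l: "l < n" for l
    proof -
      have \<tau>l: "\<tau> l < ?N" using bij_betwE[OF \<tau>] l by auto
      then have "invariant T (M0 (Suc (\<tau> l)))" "invariant T (M (Suc l))"
        using comp_series_invariant[OF M0 U] comp_series_invariant[OF M U] l by auto
      then show ?thesis
        using iso_sq_trans[OF iso[OF l] iso0[OF \<tau>l]] invariantD(1) invariantD(1)[OF invariant_Pset] by blast
    qed
    then show ?thesis
      using n bij_betw_trans[OF \<tau> \<rho>] by (intro conjI exI[of _ "\<rho> \<circ> \<tau>"]) auto
  qed
  then show ?thesis using M0 by blast
qed

section \<open>Semisimplicity of the whole module\<close>

text \<open>A complement of \<open>P 1\<close> would contain some \<open>b\<close> congruent to 1 modulo \<open>P 1\<close>; applying
  \<open>T (rad u k) 1\<close> lands in \<open>P 1\<close>, hence in \<open>K\<close>, but the coefficient of degree 0 of the image is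
  not divisible by \<open>u\<^sub>j\<^sup>2\<close>.\<close>

lemma not_semisimple:
  assumes "1 < m"
  shows "\<not> semisimple_sq T UNIV K"
proof
  assume ss: "semisimple_sq T UNIV K"
  obtain j where j: "j < k" "3 \<le> \<alpha> j"
    using less_mh_iff[of 1] assms by auto
  have jt: "j < t" using j k_le by simp
  obtain Y where Y: "invariant T Y" "P 1 \<inter> Y = K" "\<forall>x\<in>UNIV. \<exists>a\<in>P 1. \<exists>b\<in>Y. x = a + b"
    using ss invariant_Pset[of 1] Kset_subset[of 1] unfolding semisimple_sq_def by blast
  then obtain a b where ab: "a \<in> P 1" "b \<in> Y" "1 = a + b" by blast
  have "T (rad u k) 1 b \<in> P 1"
    using nilpotent_action[of "rad u k" b 0] by (simp add: Pset_0)
  then have "T (rad u k) 1 b \<in> K"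
    using invariantD(2)[OF Y(1) ab(2)] Y(2) by blast
  then have "upow (\<lambda>l. \<alpha> l - 1) dvd act (rad u k) 1 0 (coeff b 0)"
    by (auto simp: Kset_eq coeffs_dvd_iff coeff_Top dest: spec[of _ 0])
  then have "u j ^ (\<alpha> j - 1) dvd act (rad u k) 1 0 (coeff b 0)"
    using j by (simp add: upow_dvd_iff)
  then have sq: "u j * u j dvd act (rad u k) 1 0 (coeff b 0)"
    using power_le_dvd[of "u j" "\<alpha> j - 1" _ 2] j by (simp add: power2_eq_square)
  define R where "R = (\<Prod>l\<in>{..<k} - {j}. u l)"
  have R: "rad u k = u j * R"
    unfolding rad_def R_def using j by (intro prod.remove) auto
  have "{..<k} - {j} \<subseteq> {..<t}" using k_le by auto
  then have uR: "\<not> u j dvd R"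
    using u_not_dvd_prod_pow[of j "{..<k} - {j}" "\<lambda>_. 1"] jt by (simp add: R_def)
  \<comment> \<open>In degree 0 the \<open>delta0\<close> term, the only one with the derivative of
    \<open>g\<close>, is absent, so a factor of \<open>g\<close> can be pulled out.\<close>
  have "act (rad u k) 1 0 (coeff b 0) = u j * act R 1 0 (coeff b 0)"
    by (simp add: act_def R algebra_simps)
  then have "u j dvd act R 1 0 (coeff b 0)"
    using sq u_nonzero[OF jt] by simp
  moreover have "upow (\<lambda>_. 0) = 1" by (simp add: upow_def)
  moreover have "wt (\<lambda>_. 0) j 1 0 \<noteq> 0" using wt_Suc_0[of "\<lambda>_. 0" j 0] j by simp
  ultimately have ub: "u j dvd coeff b 0"
    using act_dvd_iff[of j "\<lambda>_. 0" "coeff b 0" R 1 0] j uR by simp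
  have "u j dvd coeff a 0"
  proof -
    have "upow (lev 1) dvd coeff a 0" using ab by (simp add: Pset_eq coeffs_dvd_iff)
    moreover have "lev 1 j = 1" using j by (simp add: lev_def)
    ultimately show ?thesis using j by (auto simp: upow_dvd_iff dest: spec[of _ j])
  qed
  with ub have "u j dvd coeff a 0 + coeff b 0" by (rule dvd_add[rotated])
  also have "coeff a 0 + coeff b 0 = 1"
    using arg_cong[OF ab(3), of "\<lambda>p. coeff p 0"] by simp
  finally show False using u_not_dvd_1[OF jt] by blast
qed

lemma semisimple_iff:
  assumes "\<And>j l. j < k \<Longrightarrow> l < k \<Longrightarrow> u l dvd e j - (if l = j then 1 else 0)"
  shows "semisimple_sq T UNIV K \<longleftrightarrow> m \<le> 1"
proof
  show "m \<le> 1" if "semisimple_sq T UNIV K"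
    using that not_semisimple by force
  assume "m \<le> 1"
  moreover have "0 < m"
    using less_mh_iff[of 0] k_pos \<alpha>_big by (metis add_0 less_eq_Suc_le One_nat_def)
  ultimately have "m = 1" by simp
  then show "semisimple_sq T UNIV K"
    using semisimple_factor[OF assms, of 0] Pset_0 Pset_mh by simp
qed

text \<open>A cube dividing h contains the cube of a prime, which must be some \<open>u j\<close>;
  its exponent is then at least 3, and this places \<open>j\<close> below \<open>k\<close>.\<close>

lemma mh_le_1_iff: "m \<le> 1 \<longleftrightarrow> \<not> (\<exists>p. 0 < degree p \<and> p ^ 3 dvd hP u \<alpha> t)"
proof -
  have split: "hP u \<alpha> t = (\<Prod>l\<in>{..<t} - {j}. u l ^ \<alpha> l) * u j ^ \<alpha> j" if "j < t" for j
    unfolding hP_def using that by (subst prod.remove[of _ j]) (auto simp: mult.commute)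
  have "(\<exists>p. 0 < degree p \<and> p ^ 3 dvd hP u \<alpha> t) \<longleftrightarrow> (\<exists>j<k. 3 \<le> \<alpha> j)"
  proof
    assume "\<exists>p. 0 < degree p \<and> p ^ 3 dvd hP u \<alpha> t"
    then obtain p where p: "0 < degree p" "p ^ 3 dvd hP u \<alpha> t" by blast
    have p0: "p \<noteq> 0" using p by auto
    then have "\<not> is_unit p" using p is_unit_iff_degree[OF p0] by simp
    with p0 obtain q where q: "q dvd p" "prime q" using prime_divisor_exists by blast
    have q3: "q ^ 3 dvd hP u \<alpha> t"
      using dvd_power_same[OF q(1)] p(2) dvd_trans by blast
    then have "q dvd hP u \<alpha> t"
      using dvd_power[of 3 q] dvd_trans by force
    then obtain j where j: "j < t" "q dvd u j ^ \<alpha> j"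
      unfolding hP_def using q(2) prime_dvd_prod_iff[of "{..<t}" q "\<lambda>j. u j ^ \<alpha> j"] by auto
    then have "q = u j"
      using primes_dvd_imp_eq[OF q(2) u_prime] prime_dvd_power[OF q(2)] by blast
    then have "u j ^ 3 dvd u j ^ \<alpha> j"
      using q3 split[OF j(1)] u_pow_dvd_mult_iff[OF j(1)] u_not_dvd_prod_pow[OF j(1), of "{..<t} - {j}" \<alpha>]
      by auto
    then have "3 \<le> \<alpha> j"
      using dvd_power_iff[OF u_nonzero[OF j(1)]] u_prime_elem[OF j(1)] by (auto dest: prime_elem_not_unit)
    then show "\<exists>j<k. 3 \<le> \<alpha> j"
      using \<alpha>_one j(1) by (intro exI[of _ j]) (auto simp: not_less[symmetric])
  next
    assume "\<exists>j<k. 3 \<le> \<alpha> j"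
    then obtain j where j: "j < k" "3 \<le> \<alpha> j" by blast
    then have jt: "j < t" using k_le by simp
    have "u j ^ 3 dvd hP u \<alpha> t"
      using split[OF jt] le_imp_power_dvd[OF j(2), of "u j"] by simp
    then show "\<exists>p. 0 < degree p \<and> p ^ 3 dvd hP u \<alpha> t"
      using u_degree[OF jt] by blast
  qed
  moreover have "(\<exists>j<k. 3 \<le> \<alpha> j) \<longleftrightarrow> 1 < m"
    using less_mh_iff[of 1] by (simp add: numeral_3_eq_3)
  ultimately show ?thesis by (metis not_le)
qed

end

theorem theorem6p7:
  fixes u :: "nat \<Rightarrow> 'a::{field_char_0,field_gcd} poly" and \<alpha> :: "nat \<Rightarrow> nat" and t k :: nat
    and e :: "nat \<Rightarrow> 'a poly" and \<nu> :: "'a poly"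
  assumes u_irr: "\<forall>j<t. lead_coeff (u j) = 1 \<and> irreducible (u j)"
    and u_dist: "inj_on u {..<t}"
    and k_pos: "1 \<le> k" and k_le: "k \<le> t"
    and \<alpha>_big: "\<forall>j<k. 2 \<le> \<alpha> j" and \<alpha>_one: "\<forall>j. k \<le> j \<and> j < t \<longrightarrow> \<alpha> j = 1"
    and e_idem: "\<forall>j<k. \<forall>l<k. u l ^ (\<alpha> l - 1) dvd e j - (if l = j then 1 else 0)"
    and \<nu>_def: "rad u k dvd \<nu> * delta0 u \<alpha> t 1 - 1"
  defines "T \<equiv> Top u \<alpha> t" and "K \<equiv> Kset u \<alpha> t" and "P \<equiv> Pset u \<alpha> k"
    and "m \<equiv> mh \<alpha> k" and "h \<equiv> hP u \<alpha> t"
  shows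
    \<comment> \<open>(a)\<close>
    "(P 0 = UNIV \<and> P m = K \<and> (\<forall>i\<le>m. invariant T (P i) \<and> K \<subseteq> P i) \<and>
      (\<forall>i<m. P (Suc i) \<subset> P i))
    \<and>
    \<comment> \<open>(b)\<close>
     (\<forall>i<m.
        semisimple_sq T (P i) (P (Suc i)) \<and>
        direct_sum_sq T (P i) (P (Suc i)) {j. j < k \<and> i + 2 \<le> \<alpha> j} (Vbar u \<alpha> k i) \<and>
        (\<forall>g n. rad u k dvd g \<longrightarrow> (\<forall>p\<in>P i. T g n p \<in> P (Suc i))) \<and>
        (\<forall>j<k. i + 2 \<le> \<alpha> j \<longrightarrow>
           irred_sq T (Vbar u \<alpha> k i j) (P (Suc i)) \<and>
           (\<forall>q<k. \<forall>g f n l.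
              - T (g * e q * \<nu>) n (monom (Theta u \<alpha> k i * f * e j) l)
              - (if q = j then monom (smult (of_nat l - of_nat n * (of_nat (\<alpha> j - i) / of_nat (\<alpha> j - 1)))
                                        (Theta u \<alpha> k i * f * g * e j)) (n + l - 1) else 0)
              \<in> P (Suc i))))
    \<and>
     (\<forall>i i' j j'. i < m \<and> i' < m \<and> j < k \<and> j' < k \<and> i + 2 \<le> \<alpha> j \<and> i' + 2 \<le> \<alpha> j' \<longrightarrow>
        (iso_sq T (Vbar u \<alpha> k i j) (P (Suc i)) (Vbar u \<alpha> k i' j') (P (Suc i'))
           \<longleftrightarrow> i = i' \<and> j = j'))
    \<and>
    \<comment> \<open>(c)\<close>
     ((\<exists>M. comp_series T UNIV K M (\<Sum>j<k. \<alpha> j - 1)) \<and>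
      (\<forall>M n. comp_series T UNIV K M n \<longrightarrow> n = (\<Sum>j<k. \<alpha> j - 1) \<and>
         (\<exists>\<sigma>. bij_betw \<sigma> {..<n} {(i, j). i < m \<and> j < k \<and> i + 2 \<le> \<alpha> j} \<and>
            (\<forall>l<n. iso_sq T (M (Suc l)) (M l)
                      (Vbar u \<alpha> k (fst (\<sigma> l)) (snd (\<sigma> l))) (P (Suc (fst (\<sigma> l)))))))  \<and>
      size (prime_factorization (gcd h (pderiv h))) = (\<Sum>j<k. \<alpha> j - 1))
    \<and>
    \<comment> \<open>(d)\<close>
     ((semisimple_sq T UNIV K \<longleftrightarrow> m \<le> 1) \<and>
      (m \<le> 1 \<longleftrightarrow> \<not> (\<exists>p. 0 < degree p \<and> p ^ 3 dvd h)))"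
proof -
  interpret F: factored_poly u \<alpha> t k
    by unfold_locales (fact u_irr u_dist k_pos k_le \<alpha>_big \<alpha>_one)+
  \<comment> \<open>As \<open>\<alpha> l - 1\<close> is at least 1, the idempotent congruences can
    be reduced modulo \<open>u l\<close>, that is, from D to its quotient by
    \<open>rad u k\<close>.\<close>
  have e: "u l dvd e j - (if l = j then 1 else 0)" if "j < k" "l < k" for j l
  proof -
    have "u l dvd u l ^ (\<alpha> l - 1)"
      using \<alpha>_big that(2) by (intro dvd_power) force
    then show ?thesis using e_idem that dvd_trans by blast
  qed
  show ?thesis
    unfolding T_def K_def P_def m_def h_def
    using F.filtration F.semisimple_factor[OF e] F.direct_sum_Vbar[OF e] F.nilpotent_action
      F.irred_Vbar F.witt_action[OF e \<nu>_def] F.iso_Vbar_iff F.composition_series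
      F.size_prime_factorization_gcd F.semisimple_iff[OF e] F.mh_le_1_iff
    by (intro conjI allI impI ballI) auto
qed

end
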